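(* Let $k>0$, $\alpha\in(0,1]$, and $f(x)=\dfrac{k\alpha}{x^{1-\alpha}}$ for $x>0$. Let $q_0\neq 0$, let $q:[0,T]\to\mathbb{R}$ be absolutely continuous with $q(0)=q_0$ and $q(T)=0$, let $v_t=-q'(t)$ for $t\in[0,T]$ and $v_t=0$, $q_t=0$ for $t>T$, and let $$dS_t=\sigma\,dW_t-f(|q_0-q_t|)\,v_t\,dt,\qquad dX_t=v_tS_t\,dt-h(t,v_t)\,v_t\,dt .$$ Let $\delta\ge 0$ and $T'=T+\delta$. Then $$S_{T'}-S_0=-k\,\mathrm{sgn}(q_0)|q_0|^\alpha+\epsilon_1,$$ $$\frac{S_{T'}+\alpha S_0}{1+\alpha}-\frac{X_T-X_0}{q_0}=\frac{1}{q_0}\int_0^T h(t,v_t)\,v_t\,dt+\epsilon_2,$$ where $(\epsilon_1,\epsilon_2)$ is a Gaussian vector with mean $0$ and covariance matrix $$\sigma^2\begin{pmatrix} T+\delta & \frac{\delta}{1+\alpha}-\int_0^T\left(\frac{q_t}{q_0}-\frac{1}{1+\alpha}\right)dt\\[2mm] \frac{\delta}{1+\alpha}-\int_0^T\left(\frac{q_t}{q_0}-\frac{1}{1+\alpha}\right)dt & \frac{\delta}{(1+\alpha)^2}+\int_0^T\left(\frac{q_t}{q_0}-\frac{1}{1+\alpha}\right)^2dt\end{pmatrix}.$$ In particular, if $q_t=q_0\left(1-\frac tT\right)$ for $t\in[0,T]$, then $(\epsilon_1,\epsilon_2)$ is a Gaussian vector with mean $0$ and covariance matrix $$\sigma^2\begin{pmatrix}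 T+\delta & \frac{\delta}{1+\alpha}+T\left(\frac{1}{1+\alpha}-\frac12\right)\\[2mm] \frac{\delta}{1+\alpha}+T\left(\frac{1}{1+\alpha}-\frac12\right) & \frac{\delta}{(1+\alpha)^2}+\frac T3\,\frac{1+\alpha^3}{(1+\alpha)^3}\end{pmatrix}.$$
   Context: $(\Omega,\mathcal{F},(\mathcal{F}_t)_{t\ge 0},\mathbb{P})$ is a filtered probability space satisfying the usual conditions, carrying a standard one-dimensional Brownian motion $W$ with $W_0=0$; $T>0$ and $\sigma>0$ are constants; $S_0$ and $X_0$ are deterministic real numbers. A strategy is a deterministic absolutely continuous function $q:[0,T]\to\mathbb{R}$ (write $q_t=q(t)$). No trading takes place after time $T$. The function $h:[0,T]\times\mathbb{R}\to\mathbb{R}$ is measurable and $h(t,v)$ has the same sign as $v$, so that $h(t,v)v\ge 0$ (the case $h=0$ is allowed). The dynamics are understood in integral form, all Lebesgue integrals being assumed well defined: $t\mapsto f(|q_0-q_t|)v_t$ and $t\mapsto h(t,v_t)v_t$ are integrable on $[0,T]$, where $f(|q_0-q_t|)v_t$ is taken to be $0$ when $v_t=0$; the value of $f$ at $0$ is irrelevant and may be set to any positive number. *)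

theory Defs
  imports "HOL-Probability.Probability"
begin

text \<open>
  Filtered probability space \<open>(M, F)\<close> under the usual conditions. Time is a nonnegative real;
  \<open>F t\<close> is unconstrained for negative \<open>t\<close>. The completeness clause also forces \<open>M\<close> to be complete.
\<close>

definition usual_filtration :: "'a measure \<Rightarrow> (real \<Rightarrow> 'a measure) \<Rightarrow> bool" where
  "usual_filtration M F \<longleftrightarrow>
     (\<forall>t\<ge>0. subalgebra M (F t)) \<and>
     (\<forall>s t. 0 \<le> s \<longrightarrow> s \<le> t \<longrightarrow> sets (F s) \<subseteq> sets (F t)) \<and>
     (\<forall>N\<in>null_sets M. \<forall>A\<subseteq>N. A \<in> sets (F 0)) \<and>
     (\<forall>t\<ge>0. sets (F t) = (\<Inter>s\<in>{t<..}. sets (F s)))"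

definition brownian_motion ::
    "'a measure \<Rightarrow> (real \<Rightarrow> 'a measure) \<Rightarrow> (real \<Rightarrow> 'a \<Rightarrow> real) \<Rightarrow> bool" where
  "brownian_motion M F W \<longleftrightarrow>
     (\<forall>t\<ge>0. W t \<in> borel_measurable (F t)) \<and>
     (AE \<omega> in M. W 0 \<omega> = 0) \<and>
     (AE \<omega> in M. continuous_on {0..} (\<lambda>t. W t \<omega>)) \<and>
     (\<forall>s t. 0 \<le> s \<longrightarrow> s < t \<longrightarrow>
        distributed M lborel (\<lambda>\<omega>. W t \<omega> - W s \<omega>) (normal_density 0 (sqrt (t - s))) \<and>
        prob_space.indep_set M (sets (F s))
          (sets (vimage_algebra (space M) (\<lambda>\<omega>. W t \<omega> - W s \<omega>) borel)))"

definition absolutely_continuous_on_interval ::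
    "real \<Rightarrow> real \<Rightarrow> (real \<Rightarrow> real) \<Rightarrow> bool" where
  "absolutely_continuous_on_interval l u f \<longleftrightarrow>
     (\<forall>e>0. \<exists>d>0. \<forall>(n::nat) (a::nat \<Rightarrow> real) (b::nat \<Rightarrow> real).
        (\<forall>i<n. l \<le> a i \<and> a i \<le> b i \<and> b i \<le> u) \<longrightarrow>
        (\<forall>i<n. \<forall>j<n. i \<noteq> j \<longrightarrow> {a i<..<b i} \<inter> {a j<..<b j} = {}) \<longrightarrow>
        (\<Sum>i<n. b i - a i) < d \<longrightarrow>
        (\<Sum>i<n. \<bar>f (b i) - f (a i)\<bar>) < e)"

text \<open>
  A constant is a (degenerate) Gaussian variable, so singular covariance matrices are allowed.
  The second parameter of \<open>normal_density\<close> is the standard deviation.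
\<close>

definition gaussian_variable :: "'a measure \<Rightarrow> ('a \<Rightarrow> real) \<Rightarrow> bool" where
  "gaussian_variable M Y \<longleftrightarrow>
     Y \<in> borel_measurable M \<and>
     ((\<exists>\<mu>. AE \<omega> in M. Y \<omega> = \<mu>) \<or>
      (\<exists>\<mu> s. s > 0 \<and> distributed M lborel Y (normal_density \<mu> s)))"

definition gaussian_vector :: "'a measure \<Rightarrow> ('a \<Rightarrow> real ^ 'n) \<Rightarrow> bool" where
  "gaussian_vector M Y \<longleftrightarrow>
     Y \<in> borel_measurable M \<and> (\<forall>u. gaussian_variable M (\<lambda>\<omega>. u \<bullet> Y \<omega>))"

definition covariance_matrix :: "'a measure \<Rightarrow> ('a \<Rightarrow> real ^ 'n) \<Rightarrow> real ^ 'n ^ 'n" where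
  "covariance_matrix M Y =
     (\<chi> i j. LINT \<omega>|M. (Y \<omega> $ i - (LINT \<omega>'|M. Y \<omega>' $ i)) * (Y \<omega> $ j - (LINT \<omega>'|M. Y \<omega>' $ j)))"

definition gaussian_vector_with ::
    "'a measure \<Rightarrow> ('a \<Rightarrow> real ^ 'n) \<Rightarrow> real ^ 'n \<Rightarrow> real ^ 'n ^ 'n \<Rightarrow> bool" where
  "gaussian_vector_with M Y \<mu> C \<longleftrightarrow>
     gaussian_vector M Y \<and> (LINT \<omega>|M. Y \<omega>) = \<mu> \<and> covariance_matrix M Y = C"

end

theory Submission
  imports Defs
begin

text \<open>
  The impact integrals are evaluated by the chain rule for absolutely continuous functions
  along \<open>u = q0 - q\<close>, so that \<open>\<epsilon>1 = \<sigma> W\<^sub>T\<^sub>'\<close> and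
  \<open>\<epsilon>2 = \<sigma> (W\<^sub>T\<^sub>' / (1 + \<alpha>) - I / q0)\<close> with \<open>I = \<integral> v W dt\<close>. Summation by parts turns
  the Riemann-Stieltjes sums of \<open>I\<close> into sums \<open>\<Sum> q \<Delta>W\<close> of independent increments, whose
  characteristic functions are explicit; passing to the limit gives the characteristic
  function of every linear combination of \<open>\<epsilon>1\<close> and \<open>\<epsilon>2\<close>, hence the joint Gaussian law.
\<close>

section \<open>Absolutely continuous functions\<close>

text \<open>The strategy is differentiable only almost everywhere and need not be monotone, so
  \<open>u\<close> may return to 0, where \<open>f\<close> is singular when \<alpha> < 1. The
  weights in the second identity come from a cancellation. An antiderivative of the price impact is
  k |y|^(1+\<alpha>) / (1+\<alpha>), so the impact part of (X_T - X_0) / q0 is 1/(1+\<alpha>) times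
  the final impact on S. Dividing S_T' by 1+\<alpha> produces the same term, and the share
  \<alpha>/(1+\<alpha>) of S0 restores the full coefficient of S0. As q has bounded variation, I is
  an ordinary integral along each path and at the same time the Wiener integral of q. Thus
  \<epsilon>2 / \<sigma> is the Wiener integral of 1/(1+\<alpha>) - q/q0 over [0,T] plus (W_T' -
  W_T) / (1+\<alpha>). The covariance entries are the L^2 products of such integrands, and the
  \<delta> terms come from the interval after T.\<close>

text \<open>Tagged divisions and divisions are finite sets rather than sequences. Enumerating the
  index set by a bijection carries the modulus over, and the same \<open>d\<close> serves every
  finite family.\<close>

lemma absolutely_continuous_on_finite_family:
  assumes ac: "absolutely_continuous_on_interval l u f" and "e > 0"
  shows "\<exists>d>0. \<forall>(D :: 'i set) a b. finite D \<longrightarrow> (\<forall>i\<in>D. l \<le> a i \<and> a i \<le> b i \<and> b i \<le> u) \<longrightarrow>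
       (\<forall>i\<in>D. \<forall>j\<in>D. i \<noteq> j \<longrightarrow> {a i<..<b i} \<inter> {a j<..<b j} = {}) \<longrightarrow>
       (\<Sum>i\<in>D. b i - a i) < d \<longrightarrow> (\<Sum>i\<in>D. \<bar>f (b i) - f (a i)\<bar>) < e"
proof -
  obtain d where d: "d > 0" and D: "\<And>(n::nat) (a::nat \<Rightarrow> real) (b::nat \<Rightarrow> real).
        (\<forall>i<n. l \<le> a i \<and> a i \<le> b i \<and> b i \<le> u) \<Longrightarrow>
        (\<forall>i<n. \<forall>j<n. i \<noteq> j \<longrightarrow> {a i<..<b i} \<inter> {a j<..<b j} = {}) \<Longrightarrow>
        (\<Sum>i<n. b i - a i) < d \<Longrightarrow>
        (\<Sum>i<n. \<bar>f (b i) - f (a i)\<bar>) < e"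
    using ac \<open>e > 0\<close> unfolding absolutely_continuous_on_interval_def by blast
  show ?thesis
  proof (intro exI[of _ d] conjI allI impI d)
    fix D :: "'i set" and a b :: "'i \<Rightarrow> real"
    assume fin: "finite D" and bnd: "\<forall>i\<in>D. l \<le> a i \<and> a i \<le> b i \<and> b i \<le> u"
      and disj: "\<forall>i\<in>D. \<forall>j\<in>D. i \<noteq> j \<longrightarrow> {a i<..<b i} \<inter> {a j<..<b j} = {}"
      and small: "(\<Sum>i\<in>D. b i - a i) < d"
    obtain h where h: "bij_betw h {..<card D} D"
      using ex_bij_betw_nat_finite[OF fin] by (auto simp: atLeast0LessThan)
    have hD: "h i \<in> D" if "i < card D" for i
      using h that by (auto simp: bij_betw_def)
    have hinj: "h i \<noteq> h j" if "i < card D" "j < card D" "i \<noteq> j" for i j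
      using h that by (auto simp: bij_betw_def inj_on_def)
    have "(\<Sum>i<card D. b (h i) - a (h i)) = (\<Sum>i\<in>D. b i - a i)"
      by (rule sum.reindex_bij_betw[OF h])
    moreover have "(\<Sum>i<card D. \<bar>f (b (h i)) - f (a (h i))\<bar>) = (\<Sum>i\<in>D. \<bar>f (b i) - f (a i)\<bar>)"
      by (rule sum.reindex_bij_betw[OF h])
    moreover have "(\<Sum>i<card D. \<bar>f (b (h i)) - f (a (h i))\<bar>) < e"
    proof (rule D)
      show "\<forall>i<card D. l \<le> a (h i) \<and> a (h i) \<le> b (h i) \<and> b (h i) \<le> u"
        using bnd hD by blast
      show "\<forall>i<card D. \<forall>j<card D. i \<noteq> j \<longrightarrow> {a (h i)<..<b (h i)} \<inter> {a (h j)<..<b (h j)} = {}"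
      proof (intro allI impI)
        fix i j assume "i < card D" "j < card D" "i \<noteq> j"
        then show "{a (h i)<..<b (h i)} \<inter> {a (h j)<..<b (h j)} = {}"
          using disj[rule_format, of "h i" "h j"] hD hinj by blast
      qed
      show "(\<Sum>i<card D. b (h i) - a (h i)) < d" using small calculation by simp
    qed
    ultimately show "(\<Sum>i\<in>D. \<bar>f (b i) - f (a i)\<bar>) < e" by simp
  qed
qed

lemma absolutely_continuous_on_subinterval:
  assumes "absolutely_continuous_on_interval l u f" "l \<le> a" "b \<le> u"
  shows "absolutely_continuous_on_interval a b f"
  unfolding absolutely_continuous_on_interval_def
proof (intro allI impI)
  fix e :: real assume "e > 0"
  then obtain d where "d > 0" and D: "\<And>(n::nat) (a::nat \<Rightarrow> real) (b::nat \<Rightarrow> real).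
        (\<forall>i<n. l \<le> a i \<and> a i \<le> b i \<and> b i \<le> u) \<Longrightarrow>
        (\<forall>i<n. \<forall>j<n. i \<noteq> j \<longrightarrow> {a i<..<b i} \<inter> {a j<..<b j} = {}) \<Longrightarrow>
        (\<Sum>i<n. b i - a i) < d \<Longrightarrow>
        (\<Sum>i<n. \<bar>f (b i) - f (a i)\<bar>) < e"
    using assms(1) unfolding absolutely_continuous_on_interval_def by blast
  show "\<exists>d>0. \<forall>(n::nat) a' b'. (\<forall>i<n. a \<le> a' i \<and> a' i \<le> b' i \<and> b' i \<le> b) \<longrightarrow>
        (\<forall>i<n. \<forall>j<n. i \<noteq> j \<longrightarrow> {a' i<..<b' i} \<inter> {a' j<..<b' j} = {}) \<longrightarrow>
        (\<Sum>i<n. b' i - a' i) < d \<longrightarrow> (\<Sum>i<n. \<bar>f (b' i) - f (a' i)\<bar>) < e"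
    using \<open>d > 0\<close> assms(2,3) by (intro exI[of _ d] conjI allI impI D) fastforce+
qed

lemma absolutely_continuous_on_interval_imp_small_oscillation:
  assumes "absolutely_continuous_on_interval l u f" "e > 0"
  obtains d where "d > 0" "\<And>x y. l \<le> x \<Longrightarrow> x \<le> y \<Longrightarrow> y \<le> u \<Longrightarrow> y - x < d \<Longrightarrow> \<bar>f y - f x\<bar> < e"
proof -
  obtain d where "d > 0" and D: "\<forall>(D :: unit set) a b. finite D \<longrightarrow> (\<forall>i\<in>D. l \<le> a i \<and> a i \<le> b i \<and> b i \<le> u) \<longrightarrow>
       (\<forall>i\<in>D. \<forall>j\<in>D. i \<noteq> j \<longrightarrow> {a i<..<b i} \<inter> {a j<..<b j} = {}) \<longrightarrow>
       (\<Sum>i\<in>D. b i - a i) < d \<longrightarrow> (\<Sum>i\<in>D. \<bar>f (b i) - f (a i)\<bar>) < e"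
    using absolutely_continuous_on_finite_family[OF assms, where 'i = unit] by blast
  show thesis
  proof (rule that[OF \<open>d > 0\<close>])
    fix x y assume "l \<le> x" "x \<le> y" "y \<le> u" "y - x < d"
    then show "\<bar>f y - f x\<bar> < e"
      using D[rule_format, of "{()}" "\<lambda>_. x" "\<lambda>_. y"] by simp
  qed
qed

lemma absolutely_continuous_on_interval_imp_continuous_on:
  assumes ac: "absolutely_continuous_on_interval l u f"
  shows "continuous_on {l..u} f"
  unfolding continuous_on_iff
proof (intro ballI allI impI)
  fix x e :: real assume x: "x \<in> {l..u}" and "e > 0"
  obtain d where d: "d > 0" "\<And>x y. l \<le> x \<Longrightarrow> x \<le> y \<Longrightarrow> y \<le> u \<Longrightarrow> y - x < d \<Longrightarrow> \<bar>f y - f x\<bar> < e"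
    using absolutely_continuous_on_interval_imp_small_oscillation[OF ac \<open>e > 0\<close>] by blast
  have "\<bar>f y - f x\<bar> < e" if "y \<in> {l..u}" "\<bar>y - x\<bar> < d" for y
    using d(2)[of x y] d(2)[of y x] x that by (cases "x \<le> y") (auto simp: abs_minus_commute)
  then show "\<exists>d>0. \<forall>x'\<in>{l..u}. dist x' x < d \<longrightarrow> dist (f x') (f x) < e"
    using \<open>d > 0\<close> by (auto simp: dist_real_def)
qed

text \<open>The Lipschitz bound concerns only values taken by \<open>f\<close>, which admits any
  \<phi> that is Lipschitz on the range of \<open>f\<close>, in particular continuously
  differentiable ones.\<close>

lemma absolutely_continuous_on_interval_lipschitz_compose:
  assumes ac: "absolutely_continuous_on_interval l u f"
    and lip: "\<And>x y. x \<in> {l..u} \<Longrightarrow> y \<in> {l..u} \<Longrightarrow> \<bar>\<phi> (f x) - \<phi> (f y)\<bar> \<le> B * \<bar>f x - f y\<bar>"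
  shows "absolutely_continuous_on_interval l u (\<lambda>x. \<phi> (f x))"
  unfolding absolutely_continuous_on_interval_def
proof (intro allI impI)
  fix e :: real assume "e > 0"
  \<comment> \<open>Passing to a positive constant keeps \<open>e / C\<close> meaningful when
    \<open>B\<close> is not positive.\<close>
  define C where "C = max B 1"
  have "C > 0" "B \<le> C" by (auto simp: C_def)
  have "e / C > 0" using \<open>e > 0\<close> \<open>C > 0\<close> by simp
  then obtain d where "d > 0" and D: "\<And>(n::nat) (a::nat \<Rightarrow> real) (b::nat \<Rightarrow> real).
        (\<forall>i<n. l \<le> a i \<and> a i \<le> b i \<and> b i \<le> u) \<Longrightarrow>
        (\<forall>i<n. \<forall>j<n. i \<noteq> j \<longrightarrow> {a i<..<b i} \<inter> {a j<..<b j} = {}) \<Longrightarrow>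
        (\<Sum>i<n. b i - a i) < d \<Longrightarrow>
        (\<Sum>i<n. \<bar>f (b i) - f (a i)\<bar>) < e / C"
    using ac unfolding absolutely_continuous_on_interval_def by blast
  show "\<exists>d>0. \<forall>(n::nat) a b. (\<forall>i<n. l \<le> a i \<and> a i \<le> b i \<and> b i \<le> u) \<longrightarrow>
        (\<forall>i<n. \<forall>j<n. i \<noteq> j \<longrightarrow> {a i<..<b i} \<inter> {a j<..<b j} = {}) \<longrightarrow>
        (\<Sum>i<n. b i - a i) < d \<longrightarrow> (\<Sum>i<n. \<bar>\<phi> (f (b i)) - \<phi> (f (a i))\<bar>) < e"
  proof (intro exI[of _ d] conjI allI impI \<open>d > 0\<close>)
    fix n :: nat and a b :: "nat \<Rightarrow> real"
    assume 1: "\<forall>i<n. l \<le> a i \<and> a i \<le> b i \<and> b i \<le> u"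
      and 2: "\<forall>i<n. \<forall>j<n. i \<noteq> j \<longrightarrow> {a i<..<b i} \<inter> {a j<..<b j} = {}"
      and 3: "(\<Sum>i<n. b i - a i) < d"
    have "\<bar>\<phi> (f (b i)) - \<phi> (f (a i))\<bar> \<le> C * \<bar>f (b i) - f (a i)\<bar>" if "i < n" for i
    proof -
      have "\<bar>\<phi> (f (b i)) - \<phi> (f (a i))\<bar> \<le> B * \<bar>f (b i) - f (a i)\<bar>"
        using 1 that by (intro lip) (auto intro: order_trans)
      also have "\<dots> \<le> C * \<bar>f (b i) - f (a i)\<bar>"
        by (intro mult_right_mono \<open>B \<le> C\<close>) auto
      finally show ?thesis .
    qed
    then have "(\<Sum>i<n. \<bar>\<phi> (f (b i)) - \<phi> (f (a i))\<bar>) \<le> (\<Sum>i<n. C * \<bar>f (b i) - f (a i)\<bar>)"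
      by (intro sum_mono) auto
    also have "\<dots> = C * (\<Sum>i<n. \<bar>f (b i) - f (a i)\<bar>)"
      by (simp add: sum_distrib_left)
    also have "\<dots> < C * (e / C)"
      using D[OF 1 2 3] \<open>C > 0\<close> by (intro mult_strict_left_mono)
    also have "\<dots> = e" using \<open>C > 0\<close> by simp
    finally show "(\<Sum>i<n. \<bar>\<phi> (f (b i)) - \<phi> (f (a i))\<bar>) < e" .
  qed
qed

text \<open>
  Tags outside the exceptional null set are handled by differentiability as in the classical
  theorem; tags in it lie in an open set of small measure, where absolute continuity makes
  the increments of the function small.
\<close>

theorem fundamental_theorem_of_calculus_absolutely_continuous:
  fixes F g :: "real \<Rightarrow> real"
  assumes "a \<le> b" and ac: "absolutely_continuous_on_interval a b F" and N: "negligible N"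
    and der: "\<And>x. x \<in> {a..b} - N \<Longrightarrow> (F has_vector_derivative g x) (at x within {a..b})"
  shows "(g has_integral (F b - F a)) {a..b}"
proof -
  \<comment> \<open>Tags in \<open>N\<close> then contribute nothing to a Riemann sum, so that only
    the increments of \<open>F\<close> over their intervals remain; the spike at the end returns to
    \<open>g\<close>.\<close>
  define g' where "g' x = (if x \<in> N then 0 else g x)" for x
  have "(g' has_integral (F b - F a)) {a..b}"
    unfolding has_integral_real
  proof (intro allI impI)
    fix e :: real assume "e > 0"
    \<comment> \<open>The differentiable tags cost at most \<open>c * (b - a)\<close>, which stays
      below half of \<open>e\<close>; adding 1 in the denominator covers
      \<open>a = b\<close>.\<close>
    define c where "c = e / 3 / (b - a + 1)"
    have "c > 0" using \<open>a \<le> b\<close> \<open>e > 0\<close> by (simp add: c_def)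
    have cba: "c * (b - a) < e / 2"
    proof -
      have "(b - a) / (b - a + 1) < 1" using \<open>a \<le> b\<close> by simp
      then have "e / 3 * ((b - a) / (b - a + 1)) < e / 3 * 1"
        using \<open>e > 0\<close> by (intro mult_strict_left_mono) auto
      then show ?thesis using \<open>e > 0\<close> by (simp add: c_def)
    qed
    have "e / 2 > 0" using \<open>e > 0\<close> by simp
    obtain d where "d > 0" and D: "\<forall>(D :: (real \<times> real set) set) A B. finite D \<longrightarrow>
        (\<forall>i\<in>D. a \<le> A i \<and> A i \<le> B i \<and> B i \<le> b) \<longrightarrow>
        (\<forall>i\<in>D. \<forall>j\<in>D. i \<noteq> j \<longrightarrow> {A i<..<B i} \<inter> {A j<..<B j} = {}) \<longrightarrow>
        (\<Sum>i\<in>D. B i - A i) < d \<longrightarrow> (\<Sum>i\<in>D. \<bar>F (B i) - F (A i)\<bar>) < e / 2"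
      using absolutely_continuous_on_finite_family[OF ac \<open>e / 2 > 0\<close>, where 'i = "real \<times> real set"]
      by blast
    have Nnull: "N \<in> null_sets lebesgue" using N negligible_iff_null_sets by blast
    obtain U where U: "open U" "N \<subseteq> U" "U - N \<in> lmeasurable" "emeasure lebesgue (U - N) < ennreal d"
      using sets_lebesgue_outer_open[of N d] Nnull \<open>d > 0\<close> by blast
    have Usets: "U \<in> sets lebesgue" using \<open>open U\<close> by auto
    have Uem: "emeasure lebesgue U < ennreal d"
      using U(4) emeasure_Diff_null_set[OF Nnull Usets] by simp
    \<comment> \<open>These radii define the gauge: around a point of \<open>N\<close> the ball
      stays in the small open set \<open>U\<close>, and around any other point of the interval the
      linear approximation has relative error at most \<open>c\<close>.\<close>
    have "\<exists>r>0. (x \<in> N \<longrightarrow> ball x r \<subseteq> U) \<and> (x \<in> {a..b} - N \<longrightarrow>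
        (\<forall>y\<in>{a..b}. norm (y-x) < r \<longrightarrow> norm (F y - F x - (y-x) *\<^sub>R g x) \<le> c * norm (y-x)))" for x
    proof (cases "x \<in> N")
      case True
      then show ?thesis using \<open>open U\<close> \<open>N \<subseteq> U\<close> by (meson DiffD2 openE subsetD)
    next
      case False
      then show ?thesis
        using der[of x, unfolded has_vector_derivative_def has_derivative_within_alt] \<open>c > 0\<close>
        by (cases "x \<in> {a..b}") (auto intro: exI[of _ 1])
    qed
    then obtain r where r: "\<And>x. r x > 0" "\<And>x. x \<in> N \<Longrightarrow> ball x (r x) \<subseteq> U"
      "\<And>x y. x \<in> {a..b} - N \<Longrightarrow> y \<in> {a..b} \<Longrightarrow> norm (y-x) < r x \<Longrightarrow>
          norm (F y - F x - (y-x) *\<^sub>R g x) \<le> c * norm (y-x)"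
      by metis
    show "\<exists>\<gamma>. gauge \<gamma> \<and> (\<forall>\<D>. \<D> tagged_division_of {a..b} \<and> \<gamma> fine \<D> \<longrightarrow>
        norm ((\<Sum>(x, k)\<in>\<D>. measure lborel k *\<^sub>R g' x) - (F b - F a)) < e)"
    proof (rule exI, safe)
      show "gauge (\<lambda>x. ball x (r x))"
        using r(1) gauge_ball_dependent by blast
    next
      fix p assume p: "p tagged_division_of {a..b}" and fine: "(\<lambda>x. ball x (r x)) fine p"
      have fin: "finite p" using p by blast
      define L R where "L = (\<lambda>z::real \<times> real set. Inf (snd z))" and "R = (\<lambda>z::real \<times> real set. Sup (snd z))"
      have K: "snd z = {L z..R z}" "a \<le> L z" "L z \<le> fst z" "fst z \<le> R z" "R z \<le> b"
          "snd z \<subseteq> ball (fst z) (r (fst z))" if z: "z \<in> p" for z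
      proof -
        obtain x k where [simp]: "z = (x, k)" by force
        have "x \<in> k" "k \<subseteq> {a..b}" using p z by auto
        moreover obtain s t where "k = cbox s t" using tagged_division_ofD(4)[OF p, of x k] z by auto
        then have st: "k = {s..t}" by simp
        ultimately have "s \<le> t" by auto
        then have "L z = s" "R z = t" by (auto simp: L_def R_def st)
        then show "snd z = {L z..R z}" "a \<le> L z" "L z \<le> fst z" "fst z \<le> R z" "R z \<le> b"
          using \<open>x \<in> k\<close> \<open>k \<subseteq> {a..b}\<close> \<open>s \<le> t\<close> by (auto simp: st)
        show "snd z \<subseteq> ball (fst z) (r (fst z))" using fine z by (auto simp: fine_def)
      qed
      have disj: "{L z<..<R z} \<inter> {L w<..<R w} = {}" if "z \<in> p" "w \<in> p" "z \<noteq> w" for z w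
      proof -
        obtain x k y m where [simp]: "z = (x, k)" "w = (y, m)" by force
        have "interior k \<inter> interior m = {}"
          using tagged_division_ofD(5)[OF p, of x k y m] that by auto
        then show ?thesis using K(1)[OF that(1)] K(1)[OF that(2)]
          by (simp only: snd_conv \<open>z = (x, k)\<close> \<open>w = (y, m)\<close>) (metis interior_atLeastAtMost_real)
      qed
      define q where "q = {z \<in> p. fst z \<in> N}"
      have q: "q \<subseteq> p" "finite q" using fin by (auto simp: q_def)
      \<comment> \<open>Total length of the intervals tagged in \<open>N\<close>: their interiors
        are disjoint and lie in \<open>U\<close>, whose measure is below \<open>d\<close>, which is
        what absolute continuity asks for.\<close>
      have "ennreal (\<Sum>z\<in>q. R z - L z) = (\<Sum>z\<in>q. emeasure lebesgue {L z<..<R z})"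
      proof (subst sum_ennreal[symmetric])
        have LR: "L z \<le> R z" if "z \<in> q" for z using K(3,4)[of z] q that by force
        then show "0 \<le> R z - L z" if "z \<in> q" for z using that by simp
        show "(\<Sum>z\<in>q. ennreal (R z - L z)) = (\<Sum>z\<in>q. emeasure lebesgue {L z<..<R z})"
          using LR by (intro sum.cong) auto
      qed
      also have "\<dots> = emeasure lebesgue (\<Union>z\<in>q. {L z<..<R z})"
      proof (rule sum_emeasure)
        show "disjoint_family_on (\<lambda>z. {L z<..<R z}) q"
          unfolding disjoint_family_on_def using q(1) disj by blast
      qed (use q in auto)
      also have "\<dots> \<le> emeasure lebesgue U"
      proof (rule emeasure_mono[OF _ Usets], rule UN_least)
        fix z assume "z \<in> q"
        then have "{L z<..<R z} \<subseteq> snd z" "snd z \<subseteq> ball (fst z) (r (fst z))" "fst z \<in> N"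
          using K q by (auto simp: q_def)
        then show "{L z<..<R z} \<subseteq> U" using r(2) by blast
      qed
      also note Uem
      finally have "(\<Sum>z\<in>q. R z - L z) < d"
      proof (subst (asm) ennreal_less_iff)
        show "0 \<le> (\<Sum>z\<in>q. R z - L z)"
          using q(1) K(3,4) by (intro sum_nonneg) (meson diff_ge_0_iff_ge order_trans subsetD)
      qed
      then have small: "(\<Sum>z\<in>q. \<bar>F (R z) - F (L z)\<bar>) < e / 2"
      proof (intro D[rule_format])
        show "finite q" by fact
        fix z assume "z \<in> q"
        then have "z \<in> p" using q by blast
        then show "a \<le> L z \<and> L z \<le> R z \<and> R z \<le> b"
          using K(2-5)[of z] by linarith
        fix w assume "w \<in> q" "z \<noteq> w"
        then show "{L z<..<R z} \<inter> {L w<..<R w} = {}" using disj \<open>z \<in> p\<close> q by blast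
      qed
      \<comment> \<open>Straddle estimate: the tag lies between the two end points, so the one-sided
        errors \<open>c * (R z - x)\<close> and \<open>c * (x - L z)\<close> add up to
        \<open>c\<close> times the length.\<close>
      have est: "\<bar>(R z - L z) * g' (fst z) - (F (R z) - F (L z))\<bar> \<le> c * (R z - L z)" if z: "z \<in> p - q" for z
      proof -
        define x where "x = fst z"
        have zp: "z \<in> p" and xN: "x \<in> {a..b} - N"
          using z K[of z] by (auto simp: q_def x_def)
        have 1: "norm (F y - F x - (y-x) *\<^sub>R g x) \<le> c * norm (y-x)" if "y \<in> {L z..R z}" for y
        proof (rule r(3)[OF xN])
          have "y \<in> ball x (r x)" using that K(1,6)[OF zp] by (auto simp: x_def)
          then show "norm (y - x) < r x" by (simp add: dist_norm norm_minus_commute)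
          show "y \<in> {a..b}" using that K(2,5)[OF zp] by auto
        qed
        have "\<bar>F (R z) - F x - (R z - x) * g x\<bar> \<le> c * (R z - x)"
          using 1[of "R z"] K(3,4)[OF zp] by (simp add: x_def)
        moreover have "\<bar>F (L z) - F x - (L z - x) * g x\<bar> \<le> c * (x - L z)"
          using 1[of "L z"] K(3,4)[OF zp] by (simp add: x_def)
        moreover have "(R z - L z) * g x - (F (R z) - F (L z))
          = (F (L z) - F x - (L z - x) * g x) - (F (R z) - F x - (R z - x) * g x)"
          by (simp add: algebra_simps)
        moreover have "c * (R z - L z) = c * (R z - x) + c * (x - L z)"
          by (simp add: algebra_simps)
        ultimately show ?thesis using xN by (auto simp: g'_def x_def[symmetric])
      qed
      have tele: "(\<Sum>z\<in>p. F (R z) - F (L z)) = F b - F a" "(\<Sum>z\<in>p. R z - L z) = b - a"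
        using additive_tagged_division_1[OF \<open>a \<le> b\<close> p, of F]
          additive_tagged_division_1[OF \<open>a \<le> b\<close> p, of "\<lambda>x. x"]
        by (simp_all add: case_prod_unfold L_def R_def)
      have "(\<Sum>(x, k)\<in>p. measure lborel k *\<^sub>R g' x) = (\<Sum>z\<in>p. (R z - L z) * g' (fst z))"
      proof (rule sum.cong[OF refl])
        fix z assume "z \<in> p"
        then have "measure lborel (snd z) = R z - L z"
          using K(1,3,4)[of z] by simp
        then show "(case z of (x, k) \<Rightarrow> measure lborel k *\<^sub>R g' x) = (R z - L z) * g' (fst z)"
          by (simp add: case_prod_unfold)
      qed
      then have "norm ((\<Sum>(x, k)\<in>p. measure lborel k *\<^sub>R g' x) - (F b - F a))
        = \<bar>\<Sum>z\<in>p. (R z - L z) * g' (fst z) - (F (R z) - F (L z))\<bar>"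
        by (simp add: tele(1)[symmetric] sum_subtractf)
      also have "\<dots> \<le> (\<Sum>z\<in>p. \<bar>(R z - L z) * g' (fst z) - (F (R z) - F (L z))\<bar>)"
        by (rule sum_abs)
      also have "\<dots> = (\<Sum>z\<in>p - q. \<bar>(R z - L z) * g' (fst z) - (F (R z) - F (L z))\<bar>)
        + (\<Sum>z\<in>q. \<bar>(R z - L z) * g' (fst z) - (F (R z) - F (L z))\<bar>)"
        by (rule sum.subset_diff[OF q(1) fin])
      also have "(\<Sum>z\<in>q. \<bar>(R z - L z) * g' (fst z) - (F (R z) - F (L z))\<bar>) = (\<Sum>z\<in>q. \<bar>F (R z) - F (L z)\<bar>)"
        by (intro sum.cong) (auto simp: q_def g'_def)
      also have "(\<Sum>z\<in>p - q. \<bar>(R z - L z) * g' (fst z) - (F (R z) - F (L z))\<bar>) \<le> (\<Sum>z\<in>p - q. c * (R z - L z))"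
        by (intro sum_mono est)
      also have "\<dots> \<le> (\<Sum>z\<in>p. c * (R z - L z))"
      proof (rule sum_mono2[OF fin])
        show "0 \<le> c * (R z - L z)" if "z \<in> p - (p - q)" for z
          using that K(3,4)[of z] \<open>c > 0\<close> by simp
      qed auto
      also have "\<dots> = c * (b - a)" by (simp add: sum_distrib_left[symmetric] tele)
      finally show "norm ((\<Sum>(x, k)\<in>p. measure lborel k *\<^sub>R g' x) - (F b - F a)) < e"
        using small cba by linarith
    qed
  qed
  then show ?thesis
    by (rule has_integral_spike[OF N, rotated]) (auto simp: g'_def)
qed

text \<open>Gauge integrability alone does not make \<open>g\<close> Lebesgue integrable; bounded
  variation of the indefinite integral does. Absolute continuity with tolerance 1 bounds the
  variation by 1 on every interval shorter than \<open>d\<close>, and finitely many such intervals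
  cover \<open>{a..b}\<close>.\<close>

lemma absolutely_integrable_derivative_absolutely_continuous:
  fixes F g :: "real \<Rightarrow> real"
  assumes "a \<le> b" and ac: "absolutely_continuous_on_interval a b F" and N: "negligible N"
    and der: "\<And>x. x \<in> {a..b} - N \<Longrightarrow> (F has_vector_derivative g x) (at x within {a..b})"
  shows "g absolutely_integrable_on {a..b}"
proof -
  \<comment> \<open>Applied to the pieces of a division, this identifies the integrals of
    \<open>g\<close> with increments of \<open>F\<close>.\<close>
  have ftc: "(g has_integral (F t - F s)) {s..t}" if "a \<le> s" "s \<le> t" "t \<le> b" for s t
    using that
    by (intro fundamental_theorem_of_calculus_absolutely_continuous[OF _ _ N]
        absolutely_continuous_on_subinterval[OF ac] has_vector_derivative_within_subset[OF der]) auto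
  obtain d where "d > 0" and D: "\<forall>(D :: real set set) A B. finite D \<longrightarrow>
        (\<forall>i\<in>D. a \<le> A i \<and> A i \<le> B i \<and> B i \<le> b) \<longrightarrow>
        (\<forall>i\<in>D. \<forall>j\<in>D. i \<noteq> j \<longrightarrow> {A i<..<B i} \<inter> {A j<..<B j} = {}) \<longrightarrow>
        (\<Sum>i\<in>D. B i - A i) < d \<longrightarrow> (\<Sum>i\<in>D. \<bar>F (B i) - F (A i)\<bar>) < 1"
    using absolutely_continuous_on_finite_family[OF ac zero_less_one, where 'i = "real set"] by blast
  have short: "g absolutely_integrable_on {s..t}" if st: "a \<le> s" "s \<le> t" "t \<le> b" "t - s < d" for s t
    unfolding box_real(2)[symmetric]
  proof (rule bounded_variation_absolutely_integrable_interval)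
    show "g integrable_on cbox s t" using ftc[OF st(1-3)] by (auto simp: integrable_on_def)
    fix P assume P: "P division_of cbox s t"
    have K: "K = {Inf K..Sup K}" "s \<le> Inf K" "Inf K \<le> Sup K" "Sup K \<le> t" if "K \<in> P" for K
    proof -
      obtain x y where "K = cbox x y" "K \<noteq> {}" "K \<subseteq> cbox s t"
        using division_ofD(2-4)[OF P \<open>K \<in> P\<close>] by auto
      then show "K = {Inf K..Sup K}" "s \<le> Inf K" "Inf K \<le> Sup K" "Sup K \<le> t" by auto
    qed
    have "(\<Sum>K\<in>P. Sup K - Inf K) = (\<Sum>K\<in>P. measure lborel K)"
    proof (rule sum.cong[OF refl])
      fix K assume "K \<in> P"
      then show "Sup K - Inf K = measure lborel K"
        using K(1,3)[of K] by (metis measure_lborel_Icc)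
    qed
    also have "\<dots> = t - s" using additive_content_division[OF P] st by simp
    finally have len: "(\<Sum>K\<in>P. Sup K - Inf K) < d" using st by simp
    have "(\<Sum>K\<in>P. norm (integral K g)) = (\<Sum>K\<in>P. \<bar>F (Sup K) - F (Inf K)\<bar>)"
    proof (rule sum.cong[OF refl])
      fix K assume "K \<in> P"
      then have "(g has_integral (F (Sup K) - F (Inf K))) {Inf K..Sup K}"
        using K(2-4)[of K] st by (intro ftc) auto
      then show "norm (integral K g) = \<bar>F (Sup K) - F (Inf K)\<bar>"
        using K(1)[OF \<open>K \<in> P\<close>] by (metis integral_unique real_norm_def)
    qed
    also have "\<dots> < 1"
    proof (rule D[rule_format])
      show "finite P" using P by blast
      show "(\<Sum>K\<in>P. Sup K - Inf K) < d" by (rule len)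
      show "a \<le> Inf K \<and> Inf K \<le> Sup K \<and> Sup K \<le> b" if "K \<in> P" for K
        using K(2-4)[OF that] st by auto
      show "{Inf K<..<Sup K} \<inter> {Inf J<..<Sup J} = {}" if "K \<in> P" "J \<in> P" "K \<noteq> J" for K J
      proof -
        have "interior K \<inter> interior J = {}" using division_ofD(5)[OF P] that by blast
        then show ?thesis using K(1)[OF that(1)] K(1)[OF that(2)]
          by (metis interior_atLeastAtMost_real)
      qed
    qed
    finally show "(\<Sum>K\<in>P. norm (integral K g)) \<le> 1" by simp
  qed
  \<comment> \<open>Enough pieces to make each of the equal length \<open>h\<close> shorter than
    \<open>d\<close>.\<close>
  obtain n :: nat where n: "(b - a) / d < real n" using reals_Archimedean2 by blast
  have "n > 0" using n \<open>a \<le> b\<close> \<open>d > 0\<close> by (cases "n = 0") (auto simp: divide_less_0_iff)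
  define h where "h = (b - a) / real n"
  have h: "0 \<le> h" "h < d" "a + real n * h = b"
    using \<open>a \<le> b\<close> \<open>n > 0\<close> n \<open>d > 0\<close> by (auto simp: h_def field_simps)
  have "g absolutely_integrable_on {a..a + real i * h}" if "i \<le> n" for i
    using that
  proof (induction i)
    case 0
    then show ?case using absolutely_integrable_on_null[of a a g] by simp
  next
    case (Suc i)
    have "real (Suc i) * h \<le> real n * h" using Suc.prems h(1) by (intro mult_right_mono) auto
    then have le: "a + real (Suc i) * h \<le> b" using h(3) by linarith
    have ge: "a \<le> a + real i * h" "a + real i * h \<le> a + real (Suc i) * h"
      using h(1) by (auto simp: algebra_simps)
    have "a + real (Suc i) * h - (a + real i * h) = h" by (simp add: algebra_simps)
    then have "g absolutely_integrable_on {a + real i * h..a + real (Suc i) * h}"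
      using ge le h(2) by (intro short) auto
    moreover have "g absolutely_integrable_on {a..a + real i * h}" using Suc by simp
    ultimately show ?case
      unfolding absolutely_integrable_on_def using ge
      by (auto intro: Henstock_Kurzweil_Integration.integrable_combine[of a "a + real i * h"])
  qed
  from this[of n] show ?thesis using h by simp
qed

section \<open>Chain rules and antiderivatives of the impact\<close>

text \<open>The range of \<open>u\<close> is compact, hence contained in some
  \<open>{-R..R}\<close>. This set is convex, so the mean value bound makes \<phi> Lipschitz on it
  and the composition is again absolutely continuous.\<close>

lemma chain_rule_absolutely_continuous:
  fixes u v \<phi> \<phi>' :: "real \<Rightarrow> real"
  assumes "a \<le> b" and ac: "absolutely_continuous_on_interval a b u" and N: "negligible N"
    and der: "\<And>x. x \<in> {a..b} - N \<Longrightarrow> (u has_real_derivative v x) (at x within {a..b})"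
    and \<phi>: "\<And>y. (\<phi> has_real_derivative \<phi>' y) (at y)" and cont: "continuous_on UNIV \<phi>'"
  shows "((\<lambda>x. \<phi>' (u x) * v x) has_integral (\<phi> (u b) - \<phi> (u a))) {a..b}"
    and "(\<lambda>x. \<phi>' (u x) * v x) absolutely_integrable_on {a..b}"
proof -
  have "compact (u ` {a..b})"
    using absolutely_continuous_on_interval_imp_continuous_on[OF ac] by (intro compact_continuous_image) auto
  then obtain R where R: "\<And>x. x \<in> {a..b} \<Longrightarrow> \<bar>u x\<bar> \<le> R"
    by (meson bounded_real compact_imp_bounded image_eqI)
  have "compact (\<phi>' ` {-R..R})"
    using continuous_on_subset[OF cont] by (intro compact_continuous_image) auto
  then obtain B where B: "\<And>y. y \<in> {-R..R} \<Longrightarrow> \<bar>\<phi>' y\<bar> \<le> B"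
    by (meson bounded_real compact_imp_bounded image_eqI)
  have ac': "absolutely_continuous_on_interval a b (\<lambda>x. \<phi> (u x))"
  proof (rule absolutely_continuous_on_interval_lipschitz_compose[OF ac])
    fix x y assume "x \<in> {a..b}" "y \<in> {a..b}"
    then have "u x \<in> {-R..R}" "u y \<in> {-R..R}" using R by (auto simp: abs_le_iff minus_le_iff)
    then show "\<bar>\<phi> (u x) - \<phi> (u y)\<bar> \<le> B * \<bar>u x - u y\<bar>"
      using field_differentiable_bound[of "{-R..R}" \<phi> \<phi>' B "u x" "u y"] B
      by (auto intro: DERIV_subset[OF \<phi>])
  qed
  have der': "((\<lambda>x. \<phi> (u x)) has_vector_derivative \<phi>' (u x) * v x) (at x within {a..b})"
    if "x \<in> {a..b} - N" for x
    using DERIV_chain2[OF \<phi> der[OF that]] by (simp add: has_real_derivative_iff_has_vector_derivative)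
  show "((\<lambda>x. \<phi>' (u x) * v x) has_integral (\<phi> (u b) - \<phi> (u a))) {a..b}"
    by (rule fundamental_theorem_of_calculus_absolutely_continuous[OF \<open>a \<le> b\<close> ac' N der'])
  show "(\<lambda>x. \<phi>' (u x) * v x) absolutely_integrable_on {a..b}"
    by (rule absolutely_integrable_derivative_absolutely_continuous[OF \<open>a \<le> b\<close> ac' N der'])
qed

text \<open>A nonzero derivative forces \<open>u\<close> to leave the value \<open>c\<close> at
  once, so every point of this set is isolated in it. Singletons are thus relatively open and
  negligible, and local negligibility suffices.\<close>

lemma negligible_level_set_nonzero_derivative:
  fixes u :: "real \<Rightarrow> real"
  shows "negligible {x \<in> S. u x = c \<and> (\<exists>w. w \<noteq> 0 \<and> (u has_real_derivative w) (at x within S))}"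
    (is "negligible ?E")
  unfolding locally_negligible_alt[of ?E]
proof
  fix x assume x: "x \<in> ?E"
  then obtain w where w: "w \<noteq> 0" "(u has_real_derivative w) (at x within S)" by blast
  \<comment> \<open>With error at most half the slope, a second nearby point of the level set would
    give \<open>\<bar>w\<bar> * \<bar>y - x\<bar> \<le> \<bar>w\<bar> * \<bar>y - x\<bar> /
    2\<close>.\<close>
  have "\<bar>w\<bar> / 2 > 0" using w by simp
  then obtain r where r: "r > 0" "\<And>y. y \<in> S \<Longrightarrow> norm (y - x) < r \<Longrightarrow>
      norm (u y - u x - w * (y - x)) \<le> \<bar>w\<bar> / 2 * norm (y - x)"
    using w(2)[unfolded has_field_derivative_def has_derivative_within_alt] by blast
  have "y = x" if "y \<in> ?E" "y \<in> ball x r" for y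
  proof (rule ccontr)
    assume "y \<noteq> x"
    have "\<bar>u y - u x - w * (y - x)\<bar> \<le> \<bar>w\<bar> / 2 * \<bar>y - x\<bar>"
      using r(2)[of y] that by (auto simp: dist_real_def abs_minus_commute)
    moreover have "u y - u x = 0" using that x by auto
    ultimately have "\<bar>w\<bar> * \<bar>y - x\<bar> \<le> \<bar>w\<bar> * \<bar>y - x\<bar> / 2" by (simp add: abs_mult)
    moreover have "\<bar>w\<bar> * \<bar>y - x\<bar> > 0" using w(1) \<open>y \<noteq> x\<close> by simp
    ultimately show False by linarith
  qed
  then have "{x} = ?E \<inter> ball x r" using x centre_in_ball[of x r] r(1) by blast
  then have "openin (top_of_set ?E) {x}" using openin_open by blast
  then show "\<exists>U. openin (top_of_set ?E) U \<and> x \<in> U \<and> negligible U" by auto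
qed

text \<open>
  The signed power is not Lipschitz at the origin. It is the limit of the smooth functions
  \<open>k * y * (y\<^sup>2 + \<epsilon>) powr ((\<alpha> - 1) / 2)\<close>, whose derivatives are dominated by a multiple of
  \<open>\<bar>y\<bar> powr (\<alpha> - 1)\<close>; where \<open>u = 0\<close>, the derivative of \<open>u\<close> vanishes almost everywhere.
\<close>

lemma integral_power_law_absolutely_continuous:
  fixes u v f :: "real \<Rightarrow> real"
  assumes "a \<le> b" and ac: "absolutely_continuous_on_interval a b u" and N: "negligible N"
    and der: "\<And>x. x \<in> {a..b} - N \<Longrightarrow> (u has_real_derivative v x) (at x within {a..b})"
    and k: "k > 0" "0 < \<alpha>" "\<alpha> \<le> 1"
    and f: "\<And>x. x > 0 \<Longrightarrow> f x = k * \<alpha> / x powr (1 - \<alpha>)"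
    and int: "(\<lambda>t. f \<bar>u t\<bar> * v t) absolutely_integrable_on {a..b}"
  shows "integral {a..b} (\<lambda>t. f \<bar>u t\<bar> * v t)
    = k * sgn (u b) * \<bar>u b\<bar> powr \<alpha> - k * sgn (u a) * \<bar>u a\<bar> powr \<alpha>"
proof -
  \<comment> \<open>The exponent that makes \<open>(y\<^sup>2) powr p\<close> equal to
    \<open>\<bar>y\<bar> powr (\<alpha> - 1)\<close> away from 0.\<close>
  define p where "p = (\<alpha> - 1) / 2"
  define \<epsilon> where "\<epsilon> n = 1 / real (Suc n)" for n
  define G where "G n y = k * y * (y\<^sup>2 + \<epsilon> n) powr p" for n y
  define g where "g n y = k * (y\<^sup>2 + \<epsilon> n) powr p + 2 * p * k * (y\<^sup>2 * (y\<^sup>2 + \<epsilon> n) powr (p - 1))" for n y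
  \<comment> \<open>At a zero of \<open>u\<close> the factor
    \<open>g n 0 = k * \<epsilon> n powr p\<close> is unbounded in \<open>n\<close> when \<alpha> <
    1. Setting the derivative to 0 on this negligible set makes \<open>v'\<close> vanish at every
    zero of \<open>u\<close>, so these points trouble neither the limit nor the majorant.\<close>
  define E where "E = N \<union> {x \<in> {a..b}. u x = 0 \<and> (\<exists>w. w \<noteq> 0 \<and> (u has_real_derivative w) (at x within {a..b}))}"
  define v' where "v' x = (if x \<in> E then 0 else v x)" for x
  have E: "negligible E"
    unfolding E_def by (intro negligible_Un N negligible_level_set_nonzero_derivative)
  have v'0: "v' x = 0" if "x \<in> {a..b}" "u x = 0" for x
    using that der[of x] by (auto simp: v'_def E_def)
  have p: "p \<le> 0" "2 * p = \<alpha> - 1" using k by (auto simp: p_def)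
  have \<epsilon>: "\<epsilon> n > 0" for n by (simp add: \<epsilon>_def)
  have \<epsilon>0: "\<epsilon> \<longlonglongrightarrow> 0" unfolding \<epsilon>_def using LIMSEQ_inverse_real_of_nat by (simp add: inverse_eq_divide)
  have pos: "y\<^sup>2 + \<epsilon> n > 0" for y n using \<epsilon>[of n] by (simp add: add_nonneg_pos)
  have sq: "(y\<^sup>2) powr p = 1 / \<bar>y\<bar> powr (1 - \<alpha>)" if "y \<noteq> 0" for y :: real
  proof -
    have "y\<^sup>2 = \<bar>y\<bar> powr 2" using that by simp
    then have "(y\<^sup>2) powr p = \<bar>y\<bar> powr (2 * p)" by (simp only: powr_powr)
    also have "\<dots> = \<bar>y\<bar> powr (- (1 - \<alpha>))" by (simp add: p)
    finally show ?thesis by (simp only: powr_minus_divide)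
  qed
  have Gder: "(G n has_real_derivative g n y) (at y)" for n y
    unfolding G_def g_def using pos[of y n] \<epsilon>[of n]
    by (auto intro!: derivative_eq_intros simp: power2_eq_square algebra_simps)
  have gcont: "continuous_on UNIV (g n)" for n
    unfolding g_def using less_imp_neq[OF pos, symmetric] by (intro continuous_intros) blast+
  \<comment> \<open>As \<open>2 * p = \<alpha> - 1\<close>, the second term of \<open>g\<close> is
    nonpositive and in absolute value at most \<open>1 - \<alpha>\<close> times the first. This
    gives both bounds, since the first term decreases in \<open>\<epsilon> n\<close>.\<close>
  have gbound: "0 \<le> g n y \<and> g n y \<le> k * (1 / \<bar>y\<bar> powr (1 - \<alpha>))" if "y \<noteq> 0" for n y
  proof
    have 1: "y\<^sup>2 * (y\<^sup>2 + \<epsilon> n) powr (p - 1) \<le> (y\<^sup>2 + \<epsilon> n) powr p"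
    proof -
      have "y\<^sup>2 * (y\<^sup>2 + \<epsilon> n) powr (p - 1) \<le> (y\<^sup>2 + \<epsilon> n) * (y\<^sup>2 + \<epsilon> n) powr (p - 1)"
        using \<epsilon>[of n] by (intro mult_right_mono) auto
      also have "\<dots> = (y\<^sup>2 + \<epsilon> n) powr p"
        using pos[of y n] by (simp add: powr_diff)
      finally show ?thesis .
    qed
    have "(1 - \<alpha>) * (y\<^sup>2 * (y\<^sup>2 + \<epsilon> n) powr (p - 1)) \<le> 1 * (y\<^sup>2 + \<epsilon> n) powr p"
      using k 1 by (intro mult_mono) auto
    then have "0 \<le> k * ((y\<^sup>2 + \<epsilon> n) powr p - (1 - \<alpha>) * (y\<^sup>2 * (y\<^sup>2 + \<epsilon> n) powr (p - 1)))"
      using k by (intro mult_nonneg_nonneg) auto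
    then show "0 \<le> g n y" unfolding g_def p(2) by (simp add: algebra_simps)
    have "2 * p * k \<le> 0" using p(1) k by (simp add: mult_nonpos_nonneg)
    then have "2 * p * k * (y\<^sup>2 * (y\<^sup>2 + \<epsilon> n) powr (p - 1)) \<le> 0"
      by (rule mult_nonpos_nonneg) simp
    then have "g n y \<le> k * (y\<^sup>2 + \<epsilon> n) powr p" by (simp add: g_def)
    also have "\<dots> \<le> k * (y\<^sup>2) powr p"
      using k p(1) \<epsilon>[of n] that by (intro mult_left_mono powr_mono2') auto
    finally show "g n y \<le> k * (1 / \<bar>y\<bar> powr (1 - \<alpha>))" by (simp add: sq[OF that])
  qed
  have glim: "(\<lambda>n. g n y) \<longlonglongrightarrow> k * \<alpha> / \<bar>y\<bar> powr (1 - \<alpha>)" if "y \<noteq> 0" for y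
  proof -
    have "(\<lambda>n. g n y) \<longlonglongrightarrow> k * (y\<^sup>2 + 0) powr p + 2 * p * k * (y\<^sup>2 * (y\<^sup>2 + 0) powr (p - 1))"
      unfolding g_def using that by (intro tendsto_intros \<epsilon>0) auto
    also have "k * (y\<^sup>2 + 0) powr p + 2 * p * k * (y\<^sup>2 * (y\<^sup>2 + 0) powr (p - 1)) = k * (1 + 2 * p) * (y\<^sup>2) powr p"
      using that by (simp add: powr_diff algebra_simps)
    finally show ?thesis using that by (simp add: p sq)
  qed
  have Glim: "(\<lambda>n. G n y) \<longlonglongrightarrow> k * sgn y * \<bar>y\<bar> powr \<alpha>" for y
  proof (cases "y = 0")
    case False
    have "(\<lambda>n. G n y) \<longlonglongrightarrow> k * y * (y\<^sup>2 + 0) powr p"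
      unfolding G_def using False by (intro tendsto_intros \<epsilon>0) auto
    also have "k * y * (y\<^sup>2 + 0) powr p = k * (sgn y * \<bar>y\<bar>) * (1 / \<bar>y\<bar> powr (1 - \<alpha>))"
      using sq[OF False] by (simp add: sgn_mult_abs)
    also have "\<dots> = k * sgn y * \<bar>y\<bar> powr \<alpha>" using False by (simp add: powr_diff)
    finally show ?thesis .
  qed (simp add: G_def)
  have chain: "((\<lambda>x. g n (u x) * v' x) has_integral (G n (u b) - G n (u a))) {a..b}" for n
    by (rule has_integral_spike[OF E _ chain_rule_absolutely_continuous(1)[OF \<open>a \<le> b\<close> ac N der Gder gcont]])
       (auto simp: v'_def)
  have "(\<lambda>n. integral {a..b} (\<lambda>x. g n (u x) * v' x)) \<longlonglongrightarrow> integral {a..b} (\<lambda>x. f \<bar>u x\<bar> * v' x)"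
  proof (rule dominated_convergence(2))
    show "(\<lambda>x. g n (u x) * v' x) integrable_on {a..b}" for n
      using chain by (auto simp: integrable_on_def)
    have "(\<lambda>x. norm (f \<bar>u x\<bar> * v x)) integrable_on {a..b}"
      using int by (simp add: absolutely_integrable_on_def)
    then have "(\<lambda>x. norm (f \<bar>u x\<bar> * v' x)) integrable_on {a..b}"
      by (rule integrable_spike[OF _ E]) (auto simp: v'_def)
    \<comment> \<open>The bound on \<open>g\<close> carries the constant \<open>k\<close> where
      \<open>f\<close> carries \<open>k * \<alpha>\<close>; the factor \<open>1 / \<alpha>\<close>
      makes up the difference.\<close>
    then show "(\<lambda>x. 1 / \<alpha> * norm (f \<bar>u x\<bar> * v' x)) integrable_on {a..b}"
      by (rule integrable_on_mult_right)
    show "norm (g n (u x) * v' x) \<le> 1 / \<alpha> * norm (f \<bar>u x\<bar> * v' x)" if "x \<in> {a..b}" for n x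
    proof (cases "u x = 0")
      case False
      have "norm (g n (u x) * v' x) = g n (u x) * \<bar>v' x\<bar>"
        using gbound[OF False, of n] by (simp add: abs_mult)
      also have "\<dots> \<le> k * (1 / \<bar>u x\<bar> powr (1 - \<alpha>)) * \<bar>v' x\<bar>"
        using gbound[OF False, of n] by (intro mult_right_mono) auto
      also have "\<dots> = 1 / \<alpha> * norm (f \<bar>u x\<bar> * v' x)"
        using f[of "\<bar>u x\<bar>"] False k by (simp add: abs_mult)
      finally show ?thesis .
    qed (use v'0[OF that] in simp)
    show "(\<lambda>n. g n (u x) * v' x) \<longlonglongrightarrow> f \<bar>u x\<bar> * v' x" if "x \<in> {a..b}" for x
    proof (cases "u x = 0")
      case False
      then show ?thesis using f[of "\<bar>u x\<bar>"] by (intro tendsto_intros) (simp add: glim)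
    qed (use v'0[OF that] in simp)
  qed
  moreover have "(\<lambda>n. integral {a..b} (\<lambda>x. g n (u x) * v' x)) = (\<lambda>n. G n (u b) - G n (u a))"
    using chain by (auto simp: integral_unique)
  moreover have "(\<lambda>n. G n (u b) - G n (u a)) \<longlonglongrightarrow> k * sgn (u b) * \<bar>u b\<bar> powr \<alpha> - k * sgn (u a) * \<bar>u a\<bar> powr \<alpha>"
    by (intro tendsto_diff Glim)
  ultimately have "integral {a..b} (\<lambda>x. f \<bar>u x\<bar> * v' x)
      = k * sgn (u b) * \<bar>u b\<bar> powr \<alpha> - k * sgn (u a) * \<bar>u a\<bar> powr \<alpha>"
    using LIMSEQ_unique by metis
  moreover have "integral {a..b} (\<lambda>x. f \<bar>u x\<bar> * v' x) = integral {a..b} (\<lambda>x. f \<bar>u x\<bar> * v x)"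
    by (rule integral_spike[OF E]) (auto simp: v'_def)
  ultimately show ?thesis by simp
qed

text \<open>At 0 the difference quotient is \<open>sgn h * \<bar>h\<bar> powr \<alpha>\<close>,
  which tends to 0 because \<alpha> is positive. So the signed power, unlike its derivative, has a
  continuously differentiable antiderivative, and the smooth chain rule covers the impact cost
  without regularisation.\<close>

lemma has_real_derivative_abs_powr:
  fixes y :: real
  assumes "\<alpha> > 0"
  shows "((\<lambda>y. \<bar>y\<bar> powr (1 + \<alpha>)) has_real_derivative (1 + \<alpha>) * (sgn y * \<bar>y\<bar> powr \<alpha>)) (at y)"
proof (cases y "0 :: real" rule: linorder_cases)
  case equal
  have "((\<lambda>h :: real. sgn h * \<bar>h\<bar> powr \<alpha>) \<longlongrightarrow> 0) (at 0)"
  proof (rule tendsto_norm_zero_cancel, rule Lim_null_comparison)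
    show "eventually (\<lambda>h :: real. norm (norm (sgn h * \<bar>h\<bar> powr \<alpha>)) \<le> \<bar>h\<bar> powr \<alpha>) (at 0)"
      by (auto simp: abs_mult sgn_if)
    have "((\<lambda>h :: real. \<bar>h\<bar> powr \<alpha>) \<longlongrightarrow> \<bar>0\<bar> powr \<alpha>) (at 0)"
      using assms by (intro tendsto_powr2 tendsto_intros) auto
    then show "((\<lambda>h :: real. \<bar>h\<bar> powr \<alpha>) \<longlongrightarrow> 0) (at 0)" by simp
  qed
  moreover have "sgn h * \<bar>h\<bar> powr \<alpha> = (\<bar>0 + h\<bar> powr (1 + \<alpha>) - \<bar>0\<bar> powr (1 + \<alpha>)) / h" if "h \<noteq> 0" for h :: real
    using that by (simp add: powr_add sgn_if)
  ultimately show ?thesis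
    unfolding DERIV_def equal
    by (auto simp del: add_0 abs_zero elim!: Lim_transform_eventually simp: eventually_at_filter)
next
  case less
  have "((\<lambda>y. (- y) powr (1 + \<alpha>)) has_real_derivative (1 + \<alpha>) * (sgn y * \<bar>y\<bar> powr \<alpha>)) (at y)"
    using less by (auto intro!: derivative_eq_intros)
  then show ?thesis
    by (rule has_field_derivative_transform_within_open[where S = "{..<0}"]) (use less in auto)
next
  case greater
  have "((\<lambda>y. y powr (1 + \<alpha>)) has_real_derivative (1 + \<alpha>) * (sgn y * \<bar>y\<bar> powr \<alpha>)) (at y)"
    using greater by (auto intro!: derivative_eq_intros)
  then show ?thesis
    by (rule has_field_derivative_transform_within_open[where S = "{0<..}"]) (use greater in auto)
qed

lemma continuous_on_sgn_abs_powr: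
  assumes "\<alpha> > 0"
  shows "continuous_on UNIV (\<lambda>y :: real. sgn y * \<bar>y\<bar> powr \<alpha>)"
proof -
  \<comment> \<open>Positive and negative parts have nonnegative base, where a power with positive
    exponent is continuous up to 0.\<close>
  have eq: "(\<lambda>y :: real. sgn y * \<bar>y\<bar> powr \<alpha>) = (\<lambda>y. max y 0 powr \<alpha> - max (- y) 0 powr \<alpha>)"
    using assms by (auto simp: sgn_if max_def fun_eq_iff)
  show ?thesis
    unfolding eq using assms by (intro continuous_on_diff continuous_on_powr' continuous_intros) auto
qed

section \<open>Gaussian limits of Brownian increments\<close>

text \<open>On each cell the error is at most the oscillation of \<open>w\<close> times the integral
  of the absolute value of \<open>v\<close>, and \<open>w\<close> is uniformly continuous. Tags are
  free because two choices occur: right end points for the sums left by summation by parts, left end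
  points with \<open>U\<close> the identity for the variances.\<close>

lemma stieltjes_sums_tendsto:
  fixes v w U :: "real \<Rightarrow> real"
  assumes "T > 0" and v: "v absolutely_integrable_on {0..T}" and w: "continuous_on {0..T} w"
    and U: "\<And>s t. 0 \<le> s \<Longrightarrow> s \<le> t \<Longrightarrow> t \<le> T \<Longrightarrow> integral {s..t} v = U t - U s"
    and \<xi>: "\<And>n i. i < n \<Longrightarrow> \<xi> n i \<in> {T * real i / real n..T * real (Suc i) / real n}"
  shows "(\<lambda>n. \<Sum>i<n. w (\<xi> n i) * (U (T * real (Suc i) / real n) - U (T * real i / real n)))
    \<longlonglongrightarrow> integral {0..T} (\<lambda>s. v s * w s)"
proof (rule LIMSEQ_I)
  fix e :: real assume "e > 0"
  define J where "J = integral {0..T} (\<lambda>s. norm (v s))"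
  have vint: "v integrable_on {0..T}" "(\<lambda>s. norm (v s)) integrable_on {0..T}"
    using v by (auto simp: absolutely_integrable_on_def)
  have "J \<ge> 0" unfolding J_def by (intro integral_nonneg vint) auto
  have "(\<lambda>s. w s * v s) absolutely_integrable_on {0..T}"
    using w by (intro absolutely_integrable_bounded_measurable_product_real v
        continuous_imp_measurable_on_sets_lebesgue compact_imp_bounded compact_continuous_image) auto
  then have vw: "(\<lambda>s. v s * w s) integrable_on {0..T}"
    by (simp add: absolutely_integrable_on_def mult.commute)
  \<comment> \<open>Tolerance for the oscillation of \<open>w\<close>; the total error is
    \<open>c * J\<close>, and adding 1 allows \<open>J = 0\<close>.\<close>
  define c where "c = e / (J + 1)"
  have c: "c > 0" "c * J < e"
  proof -
    show "c > 0" using \<open>e > 0\<close> \<open>J \<ge> 0\<close> by (simp add: c_def)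
    have "e * (J / (J + 1)) < e * 1"
      using \<open>e > 0\<close> \<open>J \<ge> 0\<close> by (intro mult_strict_left_mono) auto
    then show "c * J < e" by (simp add: c_def)
  qed
  have "uniformly_continuous_on {0..T} w" using w by (intro compact_uniformly_continuous) auto
  then obtain d where d: "d > 0" "\<And>x y. x \<in> {0..T} \<Longrightarrow> y \<in> {0..T} \<Longrightarrow> dist y x < d \<Longrightarrow> dist (w y) (w x) < c"
    using c(1) unfolding uniformly_continuous_on_def by metis
  obtain m :: nat where m: "T / d < real m" using reals_Archimedean2 by blast
  have "norm ((\<Sum>i<n. w (\<xi> n i) * (U (T * real (Suc i) / real n) - U (T * real i / real n))) -
      integral {0..T} (\<lambda>s. v s * w s)) < e" if "n \<ge> Suc m" for n
  proof -
    have n: "n > 0" "T / real n < d"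
    proof -
      show "n > 0" using that by simp
      have "T / d < real n" using m that by linarith
      then show "T / real n < d" using \<open>d > 0\<close> \<open>n > 0\<close> by (simp add: field_simps)
    qed
    define \<tau> where "\<tau> i = T * real i / real n" for i
    have \<tau>: "\<tau> 0 = 0" "\<tau> n = T" using n by (auto simp: \<tau>_def)
    have \<tau>mono: "\<tau> i \<le> \<tau> j" if "i \<le> j" for i j
      using that \<open>T > 0\<close> n by (auto simp: \<tau>_def intro!: divide_right_mono mult_left_mono)
    have \<tau>step: "\<tau> (Suc i) - \<tau> i < d" for i
    proof -
      have "\<tau> (Suc i) - \<tau> i = T / real n" by (simp add: \<tau>_def diff_divide_distrib[symmetric] algebra_simps)
      then show ?thesis using n(2) by simp
    qed
    have split: "(\<Sum>i<j. integral {\<tau> i..\<tau> (Suc i)} f) = integral {0..\<tau> j} f"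
      if "f integrable_on {0..T}" "j \<le> n" for f :: "real \<Rightarrow> real" and j
      using that(2)
    proof (induction j)
      case (Suc j)
      have "f integrable_on {0..\<tau> (Suc j)}"
        using that(1) \<tau>mono[of "Suc j" n] Suc.prems \<tau> by (auto intro: integrable_on_subinterval)
      then have "integral {0..\<tau> j} f + integral {\<tau> j..\<tau> (Suc j)} f = integral {0..\<tau> (Suc j)} f"
        using \<tau>mono[of 0 j] \<tau>mono[of j "Suc j"] \<tau>
        by (intro Henstock_Kurzweil_Integration.integral_combine) auto
      then show ?case using Suc by simp
    qed (simp add: \<tau>)
    have loc: "\<bar>w (\<xi> n i) * (U (\<tau> (Suc i)) - U (\<tau> i)) - integral {\<tau> i..\<tau> (Suc i)} (\<lambda>s. v s * w s)\<bar>
        \<le> c * integral {\<tau> i..\<tau> (Suc i)} (\<lambda>s. norm (v s))" if "i < n" for i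
    proof -
      have sub: "{\<tau> i..\<tau> (Suc i)} \<subseteq> {0..T}"
        using \<tau>mono[of 0 i] \<tau>mono[of "Suc i" n] \<tau> that by auto
      have int: "v integrable_on {\<tau> i..\<tau> (Suc i)}" "(\<lambda>s. norm (v s)) integrable_on {\<tau> i..\<tau> (Suc i)}"
        "(\<lambda>s. v s * w s) integrable_on {\<tau> i..\<tau> (Suc i)}"
        using vint vw sub by (auto intro: integrable_on_subinterval)
      have x: "\<xi> n i \<in> {\<tau> i..\<tau> (Suc i)}" using \<xi>[OF that] by (simp add: \<tau>_def)
      have "U (\<tau> (Suc i)) - U (\<tau> i) = integral {\<tau> i..\<tau> (Suc i)} v"
        using sub \<tau>mono[of i "Suc i"] by (intro U[symmetric]) auto
      then have "w (\<xi> n i) * (U (\<tau> (Suc i)) - U (\<tau> i)) - integral {\<tau> i..\<tau> (Suc i)} (\<lambda>s. v s * w s)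
        = integral {\<tau> i..\<tau> (Suc i)} (\<lambda>s. w (\<xi> n i) * v s - v s * w s)"
        using int by (simp add: Henstock_Kurzweil_Integration.integral_diff integrable_on_mult_right)
      also have "norm \<dots> \<le> integral {\<tau> i..\<tau> (Suc i)} (\<lambda>s. c * norm (v s))"
      proof (rule Henstock_Kurzweil_Integration.integral_norm_bound_integral)
        show "(\<lambda>s. w (\<xi> n i) * v s - v s * w s) integrable_on {\<tau> i..\<tau> (Suc i)}"
          using int by (intro integrable_diff integrable_on_mult_right)
        show "(\<lambda>s. c * norm (v s)) integrable_on {\<tau> i..\<tau> (Suc i)}"
          using int by (intro integrable_on_mult_right)
        fix s assume s: "s \<in> {\<tau> i..\<tau> (Suc i)}"
        have "dist (\<xi> n i) s < d" using s x \<tau>step[of i] by (auto simp: dist_real_def abs_less_iff)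
        then have "\<bar>w (\<xi> n i) - w s\<bar> \<le> c"
          using d(2)[of s "\<xi> n i"] sub s x by (auto simp: dist_real_def)
        then have "\<bar>w (\<xi> n i) - w s\<bar> * \<bar>v s\<bar> \<le> c * \<bar>v s\<bar>" by (intro mult_right_mono) auto
        then show "norm (w (\<xi> n i) * v s - v s * w s) \<le> c * norm (v s)"
          by (simp add: abs_mult[symmetric] algebra_simps)
      qed
      finally show ?thesis using int by simp
    qed
    have "\<bar>(\<Sum>i<n. w (\<xi> n i) * (U (\<tau> (Suc i)) - U (\<tau> i))) - integral {0..T} (\<lambda>s. v s * w s)\<bar>
      = \<bar>\<Sum>i<n. w (\<xi> n i) * (U (\<tau> (Suc i)) - U (\<tau> i)) - integral {\<tau> i..\<tau> (Suc i)} (\<lambda>s. v s * w s)\<bar>"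
      using split[OF vw, of n] by (simp add: sum_subtractf \<tau>)
    also have "\<dots> \<le> (\<Sum>i<n. \<bar>w (\<xi> n i) * (U (\<tau> (Suc i)) - U (\<tau> i)) - integral {\<tau> i..\<tau> (Suc i)} (\<lambda>s. v s * w s)\<bar>)"
      by (rule sum_abs)
    also have "\<dots> \<le> (\<Sum>i<n. c * integral {\<tau> i..\<tau> (Suc i)} (\<lambda>s. norm (v s)))"
      by (intro sum_mono loc) auto
    also have "\<dots> = c * J" using split[OF vint(2), of n] by (simp add: sum_distrib_left[symmetric] \<tau> J_def)
    finally show ?thesis using c(2) by (simp add: \<tau>_def)
  qed
  then show "\<exists>no. \<forall>n\<ge>no. norm ((\<Sum>i<n. w (\<xi> n i) * (U (T * real (Suc i) / real n) - U (T * real i / real n))) -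
      integral {0..T} (\<lambda>s. v s * w s)) < e" by blast
qed

lemma (in prob_space) char_distr_zero: "char (distr M borel (\<lambda>_. 0)) x = 1"
  by (simp add: char_def integral_return)

text \<open>Stated in the shape in which Gaussian characteristic functions appear below, so that
  variances of independent summands add by rewriting alone.\<close>

lemma exp_quadratic_mult:
  "complex_of_real (exp (- (a * y) / 2)) * complex_of_real (exp (- (b * y) / 2))
    = complex_of_real (exp (- ((a + b) * y) / 2))"
proof -
  have "exp (- (a * y) / 2) * exp (- (b * y) / 2) = exp (- ((a + b) * y) / 2)"
    by (subst exp_add[symmetric]) (simp add: field_simps)
  then show ?thesis by (metis of_real_mult)
qed

lemma (in prob_space) char_distr_mult:
  assumes [measurable]: "Y \<in> borel_measurable M"
  shows "char (distr M borel (\<lambda>\<omega>. c * Y \<omega>)) x = char (distr M borel Y) (c * x)"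
  by (simp add: char_def integral_distr mult_ac)

lemma (in prob_space) char_distr_tendsto:
  fixes Y :: "nat \<Rightarrow> 'a \<Rightarrow> real"
  assumes [measurable]: "\<And>n. Y n \<in> borel_measurable M" "Z \<in> borel_measurable M"
    and lim: "AE \<omega> in M. (\<lambda>n. Y n \<omega>) \<longlonglongrightarrow> Z \<omega>"
  shows "(\<lambda>n. char (distr M borel (Y n)) x) \<longlonglongrightarrow> char (distr M borel Z) x"
proof -
  have "(\<lambda>n. CLINT \<omega>|M. iexp (x * Y n \<omega>)) \<longlonglongrightarrow> (CLINT \<omega>|M. iexp (x * Z \<omega>))"
  proof (rule integral_dominated_convergence[where w = "\<lambda>_. 1"])
    show "AE \<omega> in M. (\<lambda>n. iexp (x * Y n \<omega>)) \<longlonglongrightarrow> iexp (x * Z \<omega>)"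
      using lim by eventually_elim (intro tendsto_intros)
  qed auto
  then show ?thesis by (simp add: char_def integral_distr)
qed

lemma (in prob_space) char_distr_std_normal:
  assumes D: "distributed M lborel Z std_normal_density"
  shows "char (distr M borel Z) x = complex_of_real (exp (- x\<^sup>2 / 2))"
proof -
  have "distr M borel Z = distr M lborel Z" by (rule distr_cong) auto
  also have "\<dots> = std_normal_distribution" using D by (simp add: distributed_def)
  finally show ?thesis by (simp add: char_std_normal_distribution)
qed

section \<open>Recognising Gaussian laws\<close>

text \<open>By Levy uniqueness the characteristic function determines the law. The case
  \<open>V = 0\<close> is separate because a point mass has no density; otherwise division by
  \<open>sqrt V\<close> reduces to the standard normal law, whose moments are known.\<close>

lemma (in prob_space)
  assumes Y[measurable]: "Y \<in> borel_measurable M" and "V \<ge> 0"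
    and ch: "\<And>x. char (distr M borel Y) x = complex_of_real (exp (- (V * x\<^sup>2) / 2))"
  shows gaussian_variable_if_char: "gaussian_variable M Y"
    and square_integrable_if_gaussian_char: "integrable M (\<lambda>\<omega>. (Y \<omega>)\<^sup>2)"
    and mean_if_gaussian_char: "expectation Y = 0"
    and variance_if_gaussian_char: "expectation (\<lambda>\<omega>. (Y \<omega>)\<^sup>2) = V"
proof -
  have rd: "real_distribution (distr M borel Z)" if "Z \<in> borel_measurable M" for Z
    using that by (intro real_distribution_distr)
  have "gaussian_variable M Y \<and> integrable M (\<lambda>\<omega>. (Y \<omega>)\<^sup>2) \<and> expectation Y = 0 \<and> expectation (\<lambda>\<omega>. (Y \<omega>)\<^sup>2) = V"
  proof (cases "V = 0")
    case True
    have "char (distr M borel Y) = char (distr M borel (\<lambda>_. 0))"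
      using True by (simp only: fun_eq_iff ch char_distr_zero) simp
    then have eq: "distr M borel Y = distr M borel (\<lambda>_. 0)"
      by (intro Levy_uniqueness rd) auto
    have "AE y in distr M borel Y. y = 0"
      unfolding eq by (subst AE_distr_iff) auto
    then have "AE \<omega> in M. Y \<omega> = 0" by (subst (asm) AE_distr_iff) auto
    then show ?thesis
      using True integral_cong_AE[of Y M "\<lambda>_. 0"] integral_cong_AE[of "\<lambda>\<omega>. (Y \<omega>)\<^sup>2" M "\<lambda>_. 0"]
        integrable_cong_AE[of "\<lambda>\<omega>. (Y \<omega>)\<^sup>2" M "\<lambda>_. 0"]
      by (auto simp: gaussian_variable_def elim: AE_mp)
  next
    case False
    then have V: "sqrt V > 0" "(sqrt V)\<^sup>2 = V" using \<open>V \<ge> 0\<close> by auto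
    define Z where "Z \<omega> = 1 / sqrt V * Y \<omega>" for \<omega>
    have [measurable]: "Z \<in> borel_measurable M" unfolding Z_def by simp
    have "char (distr M borel Z) x = complex_of_real (exp (- x\<^sup>2 / 2))" for x
    proof -
      have "char (distr M borel Z) x = char (distr M borel Y) (1 / sqrt V * x)"
        unfolding Z_def by (rule char_distr_mult) simp
      also have "\<dots> = complex_of_real (exp (- x\<^sup>2 / 2))"
        using V by (simp add: ch power_divide)
      finally show ?thesis .
    qed
    then have "distr M borel Z = std_normal_distribution"
      by (intro Levy_uniqueness rd real_dist_normal_dist)
        (simp_all add: fun_eq_iff char_std_normal_distribution)
    moreover have "distr M lborel Z = distr M borel Z" by (rule distr_cong) auto
    ultimately have "distributed M lborel Z std_normal_density"
      by (simp add: distributed_def)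
    then have D: "distributed M lborel Y (normal_density 0 (sqrt V))"
      using normal_standard_normal_convert[OF V(1), of Y 0] by (simp add: Z_def[abs_def] mult.commute divide_inverse)
    have "expectation Y = 0" by (rule normal_distributed_expectation[OF V(1) D])
    moreover from normal_distributed_variance[OF V(1) D] this have "expectation (\<lambda>\<omega>. (Y \<omega>)\<^sup>2) = V"
      using V by simp
    moreover have "integrable M (\<lambda>\<omega>. (Y \<omega>)\<^sup>2)"
      using distributed_integrable[OF D, of "\<lambda>x. x\<^sup>2"] integrable_normal_moment[OF V(1), of 0 2] by simp
    moreover have "gaussian_variable M Y" using D V(1) by (auto simp: gaussian_variable_def)
    ultimately show ?thesis by simp
  qed
  then show "gaussian_variable M Y" "integrable M (\<lambda>\<omega>. (Y \<omega>)\<^sup>2)" "expectation Y = 0"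
    "expectation (\<lambda>\<omega>. (Y \<omega>)\<^sup>2) = V" by auto
qed

text \<open>The law of every linear combination yields Gaussianity directly and all second moments
  by specialising the coefficients; the hypothesis \<open>nonneg\<close> makes each claimed variance
  admissible.\<close>

lemma (in prob_space) gaussian_vector_with_if_char:
  assumes [measurable]: "Y \<in> borel_measurable M" "Z \<in> borel_measurable M"
    and nonneg: "\<And>a b. a\<^sup>2 * A + 2 * a * b * B + b\<^sup>2 * C \<ge> 0"
    and ch: "\<And>a b x. char (distr M borel (\<lambda>\<omega>. a * Y \<omega> + b * Z \<omega>)) x
      = complex_of_real (exp (- ((a\<^sup>2 * A + 2 * a * b * B + b\<^sup>2 * C) * x\<^sup>2) / 2))"
  shows "gaussian_vector_with M (\<lambda>\<omega>. vector [Y \<omega>, Z \<omega>] :: real ^ 2) 0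
    (vector [vector [A, B], vector [B, C]])"
proof -
  define L where "L a b \<omega> = a * Y \<omega> + b * Z \<omega>" for a b \<omega>
  have [measurable]: "L a b \<in> borel_measurable M" for a b unfolding L_def by simp
  have L: "gaussian_variable M (L a b)" "integrable M (\<lambda>\<omega>. (L a b \<omega>)\<^sup>2)" "expectation (L a b) = 0"
     "expectation (\<lambda>\<omega>. (L a b \<omega>)\<^sup>2) = a\<^sup>2 * A + 2 * a * b * B + b\<^sup>2 * C" for a b
    using gaussian_variable_if_char[OF _ nonneg[of a b], of "L a b"]
      square_integrable_if_gaussian_char[OF _ nonneg[of a b], of "L a b"]
      mean_if_gaussian_char[OF _ nonneg[of a b], of "L a b"]
      variance_if_gaussian_char[OF _ nonneg[of a b], of "L a b"] ch[of a b]
    by (simp_all add: L_def[abs_def])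
  have Y2: "integrable M (\<lambda>\<omega>. (Y \<omega>)\<^sup>2)" "expectation Y = 0" "expectation (\<lambda>\<omega>. (Y \<omega>)\<^sup>2) = A"
    using L[of 1 0] by (simp_all add: L_def[abs_def])
  have Z2: "integrable M (\<lambda>\<omega>. (Z \<omega>)\<^sup>2)" "expectation Z = 0" "expectation (\<lambda>\<omega>. (Z \<omega>)\<^sup>2) = C"
    using L[of 0 1] by (simp_all add: L_def[abs_def])
  have S2: "integrable M (\<lambda>\<omega>. (Y \<omega> + Z \<omega>)\<^sup>2)" "expectation (\<lambda>\<omega>. (Y \<omega> + Z \<omega>)\<^sup>2) = A + 2 * B + C"
    using L[of 1 1] by (simp_all add: L_def[abs_def])
  have int: "integrable M Y" "integrable M Z"
    using Y2(1) Z2(1) by (auto intro: square_integrable_imp_integrable)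
  \<comment> \<open>Polarisation recovers the covariance from the variances of \<open>Y\<close>,
    \<open>Z\<close> and their sum: \<open>((A + 2 * B + C) - A - C) / 2 = B\<close>.\<close>
  have "(\<lambda>\<omega>. Y \<omega> * Z \<omega>) = (\<lambda>\<omega>. ((Y \<omega> + Z \<omega>)\<^sup>2 - (Y \<omega>)\<^sup>2 - (Z \<omega>)\<^sup>2) / 2)"
    by (auto simp: power2_eq_square algebra_simps)
  then have YZ: "expectation (\<lambda>\<omega>. Y \<omega> * Z \<omega>) = B"
    using Y2 Z2 S2 by simp
  have vec: "(\<lambda>\<omega>. vector [Y \<omega>, Z \<omega>] :: real ^ 2) = (\<lambda>\<omega>. Y \<omega> *\<^sub>R axis 1 1 + Z \<omega> *\<^sub>R axis 2 1)"
    by (auto simp: vec_eq_iff forall_2 axis_def)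
  have "gaussian_vector M (\<lambda>\<omega>. vector [Y \<omega>, Z \<omega>] :: real ^ 2)"
    unfolding gaussian_vector_def
  proof
    show "(\<lambda>\<omega>. vector [Y \<omega>, Z \<omega>] :: real ^ 2) \<in> borel_measurable M" unfolding vec by simp
    show "\<forall>u :: real ^ 2. gaussian_variable M (\<lambda>\<omega>. u \<bullet> vector [Y \<omega>, Z \<omega>])"
    proof
      fix u :: "real ^ 2"
      have "(\<lambda>\<omega>. u \<bullet> (vector [Y \<omega>, Z \<omega>] :: real ^ 2)) = L (u $ 1) (u $ 2)"
        by (simp add: fun_eq_iff L_def inner_vec_def sum_2)
      then show "gaussian_variable M (\<lambda>\<omega>. u \<bullet> vector [Y \<omega>, Z \<omega>])" using L(1) by simp
    qed
  qed
  moreover have "(LINT \<omega>|M. vector [Y \<omega>, Z \<omega>] :: real ^ 2) = 0"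
    unfolding vec using int Y2 Z2 by simp
  moreover have "covariance_matrix M (\<lambda>\<omega>. vector [Y \<omega>, Z \<omega>] :: real ^ 2) = vector [vector [A, B], vector [B, C]]"
  proof -
    have ZY: "expectation (\<lambda>\<omega>. Z \<omega> * Y \<omega>) = B" using YZ by (simp add: mult.commute)
    show ?thesis
      using Y2 Z2 YZ ZY by (simp add: covariance_matrix_def vec_eq_iff forall_2 power2_eq_square)
  qed
  ultimately show ?thesis by (simp add: gaussian_vector_with_def)
qed

section \<open>Brownian increments and the Wiener integral\<close>

locale filtered_brownian_motion = prob_space M for M :: "'a measure" +
  fixes F :: "real \<Rightarrow> 'a measure" and W :: "real \<Rightarrow> 'a \<Rightarrow> real"
  assumes usual: "usual_filtration M F" and brownian: "brownian_motion M F W"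
begin

lemma subalgebra_filtration: "t \<ge> 0 \<Longrightarrow> subalgebra M (F t)"
  using conjunct1[OF usual[unfolded usual_filtration_def]] by simp

lemma space_filtration: "t \<ge> 0 \<Longrightarrow> space (F t) = space M"
  using subalgebra_filtration by (simp add: subalgebra_def)

lemma measurable_filtration_mono:
  assumes "Y \<in> borel_measurable (F s)" "0 \<le> s" "s \<le> t"
  shows "Y \<in> borel_measurable (F t)"
proof (rule measurable_from_subalg[OF _ assms(1)])
  have "sets (F s) \<subseteq> sets (F t)"
    using conjunct1[OF conjunct2[OF usual[unfolded usual_filtration_def]]] assms(2,3) by simp
  then show "subalgebra (F t) (F s)"
    using assms(2,3) by (simp add: subalgebra_def space_filtration)
qed

lemma measurable_filtration_imp_measurable:
  assumes "Y \<in> borel_measurable (F s)" "0 \<le> s"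
  shows "Y \<in> borel_measurable M"
  by (rule measurable_from_subalg[OF subalgebra_filtration[OF assms(2)] assms(1)])

lemma W_adapted: "t \<ge> 0 \<Longrightarrow> W t \<in> borel_measurable (F t)"
  using conjunct1[OF brownian[unfolded brownian_motion_def]] by simp

lemma W_measurable: "t \<ge> 0 \<Longrightarrow> W t \<in> borel_measurable M"
  using measurable_filtration_imp_measurable[OF W_adapted] .

lemma char_increment:
  assumes "0 \<le> s" "s \<le> t"
  shows "char (distr M borel (\<lambda>\<omega>. W t \<omega> - W s \<omega>)) x = complex_of_real (exp (- ((t - s) * x\<^sup>2) / 2))"
\<comment> \<open>\<open>brownian_motion\<close> prescribes a density for \<open>s < t\<close> only;
  equal times give a zero increment and the factor 1.\<close>
proof (cases "s = t")
  case True
  then show ?thesis by (simp add: char_distr_zero del: distr_const)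
next
  case False
  then have st: "sqrt (t - s) > 0" "(sqrt (t - s))\<^sup>2 = t - s" using assms by auto
  have [measurable]: "W s \<in> borel_measurable M" "W t \<in> borel_measurable M"
    using assms W_measurable by auto
  have "distributed M lborel (\<lambda>\<omega>. W t \<omega> - W s \<omega>) (normal_density 0 (sqrt (t - s)))"
    using brownian assms False by (simp add: brownian_motion_def)
  then have D: "distributed M lborel (\<lambda>\<omega>. (W t \<omega> - W s \<omega>) / sqrt (t - s)) std_normal_density"
    using normal_standard_normal_convert[OF st(1), of "\<lambda>\<omega>. W t \<omega> - W s \<omega>" 0] by simp
  have "(\<lambda>\<omega>. W t \<omega> - W s \<omega>) = (\<lambda>\<omega>. sqrt (t - s) * ((W t \<omega> - W s \<omega>) / sqrt (t - s)))"
    using st by simp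
  then have "char (distr M borel (\<lambda>\<omega>. W t \<omega> - W s \<omega>)) x
    = char (distr M borel (\<lambda>\<omega>. sqrt (t - s) * ((W t \<omega> - W s \<omega>) / sqrt (t - s)))) x" by simp
  also have "\<dots> = char (distr M borel (\<lambda>\<omega>. (W t \<omega> - W s \<omega>) / sqrt (t - s))) (sqrt (t - s) * x)"
    by (rule char_distr_mult) simp
  also have "\<dots> = complex_of_real (exp (- ((t - s) * x\<^sup>2) / 2))"
    using st by (simp add: char_distr_std_normal[OF D] power_mult_distrib)
  finally show ?thesis .
qed

lemma indep_var_increment:
  assumes Y: "Y \<in> borel_measurable (F s)" and st: "0 \<le> s" "s < t"
  shows "indep_var borel Y borel (\<lambda>\<omega>. W t \<omega> - W s \<omega>)"
  unfolding indep_var_eq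
proof (intro conjI)
  have "indep_set (sets (F s)) (sets (vimage_algebra (space M) (\<lambda>\<omega>. W t \<omega> - W s \<omega>) borel))"
    using brownian st by (simp add: brownian_motion_def)
  moreover have "sigma_sets (space M) {Y -` A \<inter> space M |A. A \<in> sets borel} \<subseteq> sets (F s)"
    using measurable_sets[OF Y] sets.top[of "F s"] space_filtration[OF st(1)]
    by (intro sets.sigma_sets_subset') auto
  ultimately show "indep_set (sigma_sets (space M) {Y -` A \<inter> space M |A. A \<in> sets borel})
     (sigma_sets (space M) {(\<lambda>\<omega>. W t \<omega> - W s \<omega>) -` A \<inter> space M |A. A \<in> sets borel})"
    unfolding indep_sets2_eq sets_vimage_algebra by blast
  show "random_variable borel Y" by (rule measurable_filtration_imp_measurable[OF Y st(1)])
  show "random_variable borel (\<lambda>\<omega>. W t \<omega> - W s \<omega>)"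
    using st by (intro borel_measurable_diff W_measurable) auto
qed

text \<open>Independence of the increment from \<open>F s\<close> factorises the characteristic
  function. As \<open>Y\<close> may be any variable known at time \<open>s\<close>, this serves as
  the induction step for partial sums and for appending the interval after \<open>T\<close>.\<close>

lemma char_add_increment:
  assumes Y: "Y \<in> borel_measurable (F s)" and st: "0 \<le> s" "s \<le> t"
  shows "char (distr M borel (\<lambda>\<omega>. Y \<omega> + c * (W t \<omega> - W s \<omega>))) x
    = char (distr M borel Y) x * complex_of_real (exp (- (c\<^sup>2 * (t - s) * x\<^sup>2) / 2))"
proof (cases "s = t")
  case False
  then have "indep_var borel Y borel (\<lambda>\<omega>. W t \<omega> - W s \<omega>)"
    using st by (intro indep_var_increment Y) auto
  then have "indep_var borel (id \<circ> Y) borel ((*) c \<circ> (\<lambda>\<omega>. W t \<omega> - W s \<omega>))"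
    by (rule indep_var_compose) auto
  then have "char (distr M borel (\<lambda>\<omega>. Y \<omega> + c * (W t \<omega> - W s \<omega>))) x
    = char (distr M borel Y) x * char (distr M borel (\<lambda>\<omega>. c * (W t \<omega> - W s \<omega>))) x"
    by (intro char_distr_add) (simp add: comp_def)
  also have "char (distr M borel (\<lambda>\<omega>. c * (W t \<omega> - W s \<omega>))) x
     = char (distr M borel (\<lambda>\<omega>. W t \<omega> - W s \<omega>)) (c * x)"
    using W_measurable st by (intro char_distr_mult) auto
  finally show ?thesis using st by (simp add: char_increment power_mult_distrib mult_ac)
qed simp

text \<open>Adaptedness of a partial sum is what makes the next increment independent of it, so both
  facts are proved together.\<close>

lemma
  assumes "mono t" "t 0 \<ge> 0"
  shows adapted_increment_sum: "(\<lambda>\<omega>. \<Sum>i<n. c i * (W (t (Suc i)) \<omega> - W (t i) \<omega>)) \<in> borel_measurable (F (t n))"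
    and char_increment_sum: "char (distr M borel (\<lambda>\<omega>. \<Sum>i<n. c i * (W (t (Suc i)) \<omega> - W (t i) \<omega>))) x
      = complex_of_real (exp (- ((\<Sum>i<n. (c i)\<^sup>2 * (t (Suc i) - t i)) * x\<^sup>2) / 2))"
proof -
  have t0: "0 \<le> t i" for i
    using monoD[OF assms(1), of 0 i] assms(2) by simp
  show ad: "(\<lambda>\<omega>. \<Sum>i<n. c i * (W (t (Suc i)) \<omega> - W (t i) \<omega>)) \<in> borel_measurable (F (t n))" for n
  proof (intro borel_measurable_sum borel_measurable_times borel_measurable_diff)
    fix i assume "i \<in> {..<n}"
    then have "t (Suc i) \<le> t n" "t i \<le> t n" using monoD[OF assms(1)] by auto
    then show "W (t (Suc i)) \<in> borel_measurable (F (t n))" "W (t i) \<in> borel_measurable (F (t n))"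
      by (intro measurable_filtration_mono[OF W_adapted] t0; simp)+
  qed auto
  show "char (distr M borel (\<lambda>\<omega>. \<Sum>i<n. c i * (W (t (Suc i)) \<omega> - W (t i) \<omega>))) x
      = complex_of_real (exp (- ((\<Sum>i<n. (c i)\<^sup>2 * (t (Suc i) - t i)) * x\<^sup>2) / 2))"
  proof (induction n)
    case 0
    show ?case by (simp add: char_distr_zero del: distr_const)
  next
    case (Suc n)
    have "char (distr M borel (\<lambda>\<omega>. (\<Sum>i<n. c i * (W (t (Suc i)) \<omega> - W (t i) \<omega>)) + c n * (W (t (Suc n)) \<omega> - W (t n) \<omega>))) x
      = complex_of_real (exp (- ((\<Sum>i<n. (c i)\<^sup>2 * (t (Suc i) - t i)) * x\<^sup>2) / 2))
        * complex_of_real (exp (- ((c n)\<^sup>2 * (t (Suc n) - t n) * x\<^sup>2) / 2))"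
      using char_add_increment[OF ad t0 monoD[OF assms(1)], of n "Suc n" "c n" x] by (simp only: Suc.IH)
    also have "\<dots> = complex_of_real (exp (- ((\<Sum>i<Suc n. (c i)\<^sup>2 * (t (Suc i) - t i)) * x\<^sup>2) / 2))"
      by (simp only: exp_quadratic_mult sum.lessThan_Suc)
    finally show ?case by simp
  qed
qed

text \<open>The variable is an almost sure limit of sums with deterministic weights
  \<open>c - d * q\<close> on the grid plus an independent increment after \<open>T\<close>. The
  variances of these sums are Riemann sums of \<open>(c - d * q t)\<^sup>2\<close> plus
  \<open>c\<^sup>2 * \<delta>\<close>, and bounded convergence passes to the limit in the
  characteristic functions.\<close>

lemma char_wiener_integral:
  assumes "T > 0" "\<delta> \<ge> 0" and q: "continuous_on {0..T} q" and [measurable]: "I \<in> borel_measurable M"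
    and lim: "AE \<omega> in M. (\<lambda>n. \<Sum>i<n. q (T * real i / real n) *
        (W (T * real (Suc i) / real n) \<omega> - W (T * real i / real n) \<omega>)) \<longlonglongrightarrow> I \<omega>"
  shows "char (distr M borel (\<lambda>\<omega>. c * W (T + \<delta>) \<omega> - d * I \<omega>)) x
    = complex_of_real (exp (- ((integral {0..T} (\<lambda>t. (c - d * q t)\<^sup>2) + c\<^sup>2 * \<delta>) * x\<^sup>2) / 2))"
proof -
  define \<tau> where "\<tau> n i = T * real i / real n" for n i
  define Y where "Y n \<omega> = (\<Sum>i<n. (c - d * q (\<tau> n i)) * (W (\<tau> n (Suc i)) \<omega> - W (\<tau> n i) \<omega>))" for n \<omega>
  define Z where "Z n \<omega> = Y n \<omega> + c * (W (T + \<delta>) \<omega> - W T \<omega>)" for n \<omega>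
  \<comment> \<open>For \<open>n = 0\<close> division by zero makes the grid constantly 0, so
    monotonicity holds for all \<open>n\<close>; reaching \<open>T\<close> at index \<open>n\<close>
    requires \<open>n > 0\<close>, whence the restriction to large \<open>n\<close> below.\<close>
  have \<tau>: "mono (\<tau> n)" "\<tau> n 0 \<ge> 0" for n
    using \<open>T > 0\<close> by (auto simp: \<tau>_def mono_def intro!: divide_right_mono mult_left_mono)
  have \<tau>n: "\<tau> n n = T" if "n > 0" for n using that by (simp add: \<tau>_def)
  have [measurable]: "W (T + \<delta>) \<in> borel_measurable M" "W T \<in> borel_measurable M"
    using assms W_measurable by auto
  have ad: "Y n \<in> borel_measurable (F (\<tau> n n))" for n
    unfolding Y_def[abs_def] by (rule adapted_increment_sum[OF \<tau>])
  have [measurable]: "Y n \<in> borel_measurable M" for n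
    by (rule measurable_filtration_imp_measurable[OF ad]) (use \<open>T > 0\<close> in \<open>simp add: \<tau>_def\<close>)
  have [measurable]: "Z n \<in> borel_measurable M" for n unfolding Z_def[abs_def] by simp
  have W0: "AE \<omega> in M. W 0 \<omega> = 0" using brownian by (simp add: brownian_motion_def)
  have "AE \<omega> in M. (\<lambda>n. Z n \<omega>) \<longlonglongrightarrow> c * W (T + \<delta>) \<omega> - d * I \<omega>"
    using lim W0
  proof eventually_elim
    case (elim \<omega>)
    have "eventually (\<lambda>n. c * W (T + \<delta>) \<omega> - d * (\<Sum>i<n. q (T * real i / real n) *
        (W (T * real (Suc i) / real n) \<omega> - W (T * real i / real n) \<omega>)) = Z n \<omega>) sequentially"
      using eventually_gt_at_top[of 0]
    proof eventually_elim
      case (elim n)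
      \<comment> \<open>Since \<open>W 0 \<omega> = 0\<close>, the increments sum to
        \<open>W T \<omega>\<close>, which distributes the term \<open>c * W T\<close> over the
        cells.\<close>
      have "(\<Sum>i<n. W (\<tau> n (Suc i)) \<omega> - W (\<tau> n i) \<omega>) = W T \<omega>"
        using sum_lessThan_telescope[of "\<lambda>i. W (\<tau> n i) \<omega>" n] \<open>W 0 \<omega> = 0\<close> \<tau>n[OF elim]
        by (simp add: \<tau>_def)
      moreover have "Y n \<omega> = c * (\<Sum>i<n. W (\<tau> n (Suc i)) \<omega> - W (\<tau> n i) \<omega>)
          - d * (\<Sum>i<n. q (\<tau> n i) * (W (\<tau> n (Suc i)) \<omega> - W (\<tau> n i) \<omega>))"
        unfolding Y_def by (simp add: sum_distrib_left sum_subtractf[symmetric] algebra_simps)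
      ultimately show ?case by (simp add: Z_def \<tau>_def algebra_simps)
    qed
    then show ?case
      by (rule Lim_transform_eventually[rotated]) (intro tendsto_intros elim)
  qed
  then have 1: "(\<lambda>n. char (distr M borel (Z n)) x) \<longlonglongrightarrow> char (distr M borel (\<lambda>\<omega>. c * W (T + \<delta>) \<omega> - d * I \<omega>)) x"
    by (intro char_distr_tendsto) auto
  \<comment> \<open>The variances are Stieltjes sums with density 1, the identity as
    \<open>U\<close> and left end points as tags.\<close>
  have "(\<lambda>n. \<Sum>i<n. (c - d * q (\<tau> n i))\<^sup>2 * (T * real (Suc i) / real n - T * real i / real n))
     \<longlonglongrightarrow> integral {0..T} (\<lambda>t. 1 * (c - d * q t)\<^sup>2)"
    using \<open>T > 0\<close>
    by (intro stieltjes_sums_tendsto[where U = "\<lambda>x. x"] absolutely_integrable_continuous_real continuous_intros q)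
       (auto simp: \<tau>_def intro!: divide_right_mono mult_left_mono)
  then have var: "(\<lambda>n. \<Sum>i<n. (c - d * q (\<tau> n i))\<^sup>2 * (\<tau> n (Suc i) - \<tau> n i))
     \<longlonglongrightarrow> integral {0..T} (\<lambda>t. (c - d * q t)\<^sup>2)"
    by (simp add: \<tau>_def)
  have "(\<lambda>n. complex_of_real (exp (- (((\<Sum>i<n. (c - d * q (\<tau> n i))\<^sup>2 * (\<tau> n (Suc i) - \<tau> n i)) + c\<^sup>2 * \<delta>) * x\<^sup>2) / 2)))
      \<longlonglongrightarrow> complex_of_real (exp (- ((integral {0..T} (\<lambda>t. (c - d * q t)\<^sup>2) + c\<^sup>2 * \<delta>) * x\<^sup>2) / 2))"
    by (intro tendsto_intros var) auto
  moreover have "eventually (\<lambda>n. complex_of_real (exp (- (((\<Sum>i<n. (c - d * q (\<tau> n i))\<^sup>2 * (\<tau> n (Suc i) - \<tau> n i)) + c\<^sup>2 * \<delta>) * x\<^sup>2) / 2))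
      = char (distr M borel (Z n)) x) sequentially"
    using eventually_gt_at_top[of 0]
  proof eventually_elim
    case (elim n)
    have "Y n \<in> borel_measurable (F T)" using ad[of n] \<tau>n[OF elim] by simp
    then have "char (distr M borel (Z n)) x
      = char (distr M borel (Y n)) x * complex_of_real (exp (- (c\<^sup>2 * \<delta> * x\<^sup>2) / 2))"
      unfolding Z_def[abs_def] using \<open>T > 0\<close> \<open>\<delta> \<ge> 0\<close> by (subst char_add_increment) auto
    also have "char (distr M borel (Y n)) x
      = complex_of_real (exp (- ((\<Sum>i<n. (c - d * q (\<tau> n i))\<^sup>2 * (\<tau> n (Suc i) - \<tau> n i)) * x\<^sup>2) / 2))"
      unfolding Y_def[abs_def] by (rule char_increment_sum[OF \<tau>])
    finally show ?case by (simp only: exp_quadratic_mult)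
  qed
  ultimately have "(\<lambda>n. char (distr M borel (Z n)) x)
      \<longlonglongrightarrow> complex_of_real (exp (- ((integral {0..T} (\<lambda>t. (c - d * q t)\<^sup>2) + c\<^sup>2 * \<delta>) * x\<^sup>2) / 2))"
    by (rule Lim_transform_eventually)
  with 1 show ?thesis by (rule LIMSEQ_unique)
qed

end

section \<open>Price impact, trading proceeds and the joint law of the errors\<close>

theorem theorem2:
  fixes M :: "'a measure" and F :: "real \<Rightarrow> 'a measure"
    and W S X :: "real \<Rightarrow> 'a \<Rightarrow> real"
    and T \<sigma> S0 X0 k \<alpha> q0 \<delta> :: real
    and f q v :: "real \<Rightarrow> real" and h :: "real \<Rightarrow> real \<Rightarrow> real"
  assumes "prob_space M"
    and "usual_filtration M F"
    and "brownian_motion M F W"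
    and "T > 0" and "\<sigma> > 0"
    and h_meas: "case_prod h \<in> borel_measurable (restrict_space borel ({0..T} \<times> UNIV))"
    and h_sign: "\<And>t w. t \<in> {0..T} \<Longrightarrow> h t w * w \<ge> 0"
    and "k > 0" and "0 < \<alpha>" and "\<alpha> \<le> 1"
    and f: "\<And>x. x > 0 \<Longrightarrow> f x = k * \<alpha> / x powr (1 - \<alpha>)"
    and "q0 \<noteq> 0"
    and q_ac: "absolutely_continuous_on_interval 0 T q"
    and "q 0 = q0" and "q T = 0"
    and v: "AE t in lebesgue. t \<in> {0..T} \<longrightarrow> (q has_real_derivative - v t) (at t)"
    and after: "\<And>t. t > T \<Longrightarrow> v t = 0 \<and> q t = 0"
    and f_int: "set_integrable lebesgue {0..T} (\<lambda>t. f \<bar>q0 - q t\<bar> * v t)"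
    and h_int: "set_integrable lebesgue {0..T} (\<lambda>t. h t (v t) * v t)"
    and S: "AE \<omega> in M. \<forall>t\<ge>0.
        S t \<omega> = S0 + \<sigma> * W t \<omega> - (LINT s:{0..t}|lebesgue. f \<bar>q0 - q s\<bar> * v s)"
    and X: "AE \<omega> in M. \<forall>t\<in>{0..T}.
        X t \<omega> = X0 + (LINT s:{0..t}|lebesgue. v s * S s \<omega>)
                    - (LINT s:{0..t}|lebesgue. h s (v s) * v s)"
    and "\<delta> \<ge> 0"
  shows "\<exists>\<epsilon>1 \<epsilon>2 :: 'a \<Rightarrow> real.
    (AE \<omega> in M. S (T + \<delta>) \<omega> - S0 = - k * sgn q0 * \<bar>q0\<bar> powr \<alpha> + \<epsilon>1 \<omega>) \<and>
    (AE \<omega> in M. (S (T + \<delta>) \<omega> + \<alpha> * S0) / (1 + \<alpha>) - (X T \<omega> - X0) / q0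
        = 1 / q0 * (LINT t:{0..T}|lebesgue. h t (v t) * v t) + \<epsilon>2 \<omega>) \<and>
    gaussian_vector_with M (\<lambda>\<omega>. vector [\<epsilon>1 \<omega>, \<epsilon>2 \<omega>] :: real ^ 2) 0
      (\<sigma>\<^sup>2 *\<^sub>R vector
        [vector [T + \<delta>,
                 \<delta> / (1 + \<alpha>) - (LINT t:{0..T}|lebesgue. q t / q0 - 1 / (1 + \<alpha>))],
         vector [\<delta> / (1 + \<alpha>) - (LINT t:{0..T}|lebesgue. q t / q0 - 1 / (1 + \<alpha>)),
                 \<delta> / (1 + \<alpha>)\<^sup>2 + (LINT t:{0..T}|lebesgue. (q t / q0 - 1 / (1 + \<alpha>))\<^sup>2)]]) \<and>
    ((\<forall>t\<in>{0..T}. q t = q0 * (1 - t / T)) \<longrightarrow>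
      gaussian_vector_with M (\<lambda>\<omega>. vector [\<epsilon>1 \<omega>, \<epsilon>2 \<omega>] :: real ^ 2) 0
        (\<sigma>\<^sup>2 *\<^sub>R vector
          [vector [T + \<delta>,
                   \<delta> / (1 + \<alpha>) + T * (1 / (1 + \<alpha>) - 1 / 2)],
           vector [\<delta> / (1 + \<alpha>) + T * (1 / (1 + \<alpha>) - 1 / 2),
                   \<delta> / (1 + \<alpha>)\<^sup>2 + T / 3 * ((1 + \<alpha> ^ 3) / (1 + \<alpha>) ^ 3)]]))"
proof -
  interpret filtered_brownian_motion M F W
    using \<open>prob_space M\<close> \<open>usual_filtration M F\<close> \<open>brownian_motion M F W\<close>
    by (simp add: filtered_brownian_motion_def filtered_brownian_motion_axioms_def)
  define u where "u t = q0 - q t" for t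
  define G where "G y = sgn y * \<bar>y\<bar> powr \<alpha>" for y :: real
  define H where "H = (LINT t:{0..T}|lebesgue. h t (v t) * v t)"
  define p where "p t = q t / q0 - 1 / (1 + \<alpha>)" for t
  have u0: "u 0 = 0" "u T = q0" using \<open>q 0 = q0\<close> \<open>q T = 0\<close> by (auto simp: u_def)
  have u_ac: "absolutely_continuous_on_interval 0 T u"
    unfolding u_def
    by (rule absolutely_continuous_on_interval_lipschitz_compose[OF q_ac, of "\<lambda>y. q0 - y" 1]) auto
  have q_cont: "continuous_on {0..T} q"
    by (rule absolutely_continuous_on_interval_imp_continuous_on[OF q_ac])
  obtain N where N: "negligible N"
    and q_der: "\<And>t. t \<in> {0..T} - N \<Longrightarrow> (q has_real_derivative - v t) (at t)"
    using v unfolding eventually_ae_filter negligible_iff_null_sets by auto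
  have u_der: "(u has_real_derivative v t) (at t within S)" if "t \<in> {0..T} - N" for t S
    using DERIV_diff[OF DERIV_const[of q0] has_field_derivative_at_within[OF q_der[OF that], of S]]
    by (simp add: u_def[abs_def])
  have v_int: "v absolutely_integrable_on {0..T}"
    using \<open>T > 0\<close> u_der
    by (intro absolutely_integrable_derivative_absolutely_continuous[OF _ u_ac N])
      (auto simp: has_real_derivative_iff_has_vector_derivative)
  have v_ftc: "(v has_integral (u t - u s)) {s..t}" if "0 \<le> s" "s \<le> t" "t \<le> T" for s t
    using that u_der
    by (intro fundamental_theorem_of_calculus_absolutely_continuous[OF _ _ N]
        absolutely_continuous_on_subinterval[OF u_ac])
      (auto simp: has_real_derivative_iff_has_vector_derivative)
  have impact: "(LINT s:{0..t}|lebesgue. f \<bar>q0 - q s\<bar> * v s) = k * G (u t)" if t: "t \<in> {0..T}" for t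
  proof -
    have int: "(\<lambda>s. f \<bar>u s\<bar> * v s) absolutely_integrable_on {0..t}"
      using absolutely_integrable_on_subinterval[OF f_int, of 0 t] t by (simp add: u_def)
    have "(LINT s:{0..t}|lebesgue. f \<bar>q0 - q s\<bar> * v s) = integral {0..t} (\<lambda>s. f \<bar>u s\<bar> * v s)"
      using set_lebesgue_integral_eq_integral(2)[OF int] by (simp add: u_def)
    also have "\<dots> = k * sgn (u t) * \<bar>u t\<bar> powr \<alpha> - k * sgn (u 0) * \<bar>u 0\<bar> powr \<alpha>"
      using t u_der
      by (intro integral_power_law_absolutely_continuous[OF _ _ N _ \<open>k > 0\<close> \<open>0 < \<alpha>\<close> \<open>\<alpha> \<le> 1\<close> f int]
          absolutely_continuous_on_subinterval[OF u_ac]) auto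
    finally show ?thesis by (simp add: u0 G_def)
  qed
  \<comment> \<open>Trading has stopped after \<open>T\<close>, so the delay \<delta> adds Brownian
    noise but no impact.\<close>
  have impact_end: "(LINT s:{0..T + \<delta>}|lebesgue. f \<bar>q0 - q s\<bar> * v s) = k * G q0"
  proof -
    have "(LINT s:{0..T + \<delta>}|lebesgue. f \<bar>q0 - q s\<bar> * v s) = (LINT s:{0..T}|lebesgue. f \<bar>q0 - q s\<bar> * v s)"
      unfolding set_lebesgue_integral_def using after \<open>\<delta> \<ge> 0\<close>
      by (intro Bochner_Integration.integral_cong) (auto simp: indicator_def)
    then show ?thesis using impact[of T] \<open>T > 0\<close> u0 by simp
  qed
  \<comment> \<open>Antiderivative of the accumulated impact \<open>k * G\<close>; integrating
    impact against \<open>v\<close> yields \<open>\<phi> q0\<close>, the source of the factor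
    \<open>1 / (1 + \<alpha>)\<close>.\<close>
  define \<phi> where "\<phi> y = k / (1 + \<alpha>) * \<bar>y\<bar> powr (1 + \<alpha>)" for y :: real
  have \<phi>: "(\<phi> has_real_derivative k * G y) (at y)" for y
    using DERIV_cmult[OF has_real_derivative_abs_powr[OF \<open>0 < \<alpha>\<close>, of y], of "k / (1 + \<alpha>)"] \<open>0 < \<alpha>\<close>
    by (simp add: \<phi>_def[abs_def] G_def)
  have \<phi>': "continuous_on UNIV (\<lambda>y. k * G y)"
    unfolding G_def by (intro continuous_on_mult_left continuous_on_sgn_abs_powr \<open>0 < \<alpha>\<close>)
  have Gv: "((\<lambda>s. k * G (u s) * v s) has_integral (\<phi> (u T) - \<phi> (u 0))) {0..T}"
      "(\<lambda>s. k * G (u s) * v s) absolutely_integrable_on {0..T}"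
    using \<open>T > 0\<close> chain_rule_absolutely_continuous[OF _ u_ac N u_der \<phi> \<phi>'] by auto
  define R where "R n \<omega> = (\<Sum>i<n. q (T * real i / real n) *
      (W (T * real (Suc i) / real n) \<omega> - W (T * real i / real n) \<omega>))" for n \<omega>
  \<comment> \<open>Taking the limit as definition makes \<open>I\<close> measurable on all of
    \<open>M\<close>; on continuous paths starting at 0 it agrees with the integral of
    \<open>v s * W s \<omega>\<close>.\<close>
  define I where "I \<omega> = lim (\<lambda>n. R n \<omega>)" for \<omega>
  have W_meas[measurable]: "W (T * real i / real n) \<in> borel_measurable M" "W (T + \<delta>) \<in> borel_measurable M" for i n
    using \<open>T > 0\<close> \<open>\<delta> \<ge> 0\<close> by (auto intro!: W_measurable)
  have [measurable]: "R n \<in> borel_measurable M" for n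
    unfolding R_def[abs_def] by (intro borel_measurable_sum borel_measurable_times borel_measurable_diff W_meas) auto
  have [measurable]: "I \<in> borel_measurable M" unfolding I_def[abs_def] by measurable
  have W_path: "AE \<omega> in M. W 0 \<omega> = 0 \<and> continuous_on {0..} (\<lambda>t. W t \<omega>)"
    using brownian by (auto simp: brownian_motion_def)
  have R_lim: "(\<lambda>n. R n \<omega>) \<longlonglongrightarrow> integral {0..T} (\<lambda>s. v s * W s \<omega>)"
    if \<omega>: "W 0 \<omega> = 0" "continuous_on {0..T} (\<lambda>t. W t \<omega>)" for \<omega>
  proof -
    \<comment> \<open>Right end points are forced: summation by parts of left-point sums against
      \<open>W\<close> leaves right-point sums against \<open>u\<close>.\<close>
    have "(\<lambda>n. \<Sum>i<n. W (T * real (Suc i) / real n) \<omega> * (u (T * real (Suc i) / real n) - u (T * real i / real n)))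
      \<longlonglongrightarrow> integral {0..T} (\<lambda>s. v s * W s \<omega>)"
      using \<open>T > 0\<close> v_ftc
      by (intro stieltjes_sums_tendsto[where w = "\<lambda>t. W t \<omega>"] v_int \<omega>)
        (auto simp: integral_unique intro!: divide_right_mono mult_left_mono)
    moreover have "(\<Sum>i<n. W (T * real (Suc i) / real n) \<omega> * (u (T * real (Suc i) / real n) - u (T * real i / real n)))
       = R n \<omega>" if "n > 0" for n
    proof -
      \<comment> \<open>Boundary products of the summation by parts; they vanish at both ends
        because \<open>W 0 \<omega> = 0\<close> and \<open>q T = 0\<close>.\<close>
      define b where "b i = q (T * real i / real n) * W (T * real i / real n) \<omega>" for i
      have "b 0 = 0" "b n = 0" using \<omega>(1) \<open>q T = 0\<close> that by (auto simp: b_def)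
      then have "(\<Sum>i<n. b (Suc i) - b i) = 0" by (simp add: sum_lessThan_telescope)
      moreover have "R n \<omega> - (\<Sum>i<n. W (T * real (Suc i) / real n) \<omega> * (u (T * real (Suc i) / real n) - u (T * real i / real n)))
        = (\<Sum>i<n. b (Suc i) - b i)"
        unfolding R_def sum_subtractf[symmetric] by (intro sum.cong) (auto simp: b_def u_def algebra_simps)
      ultimately show ?thesis by simp
    qed
    ultimately show ?thesis
      by (rule Lim_transform_eventually[OF _ eventually_mono[OF eventually_gt_at_top[of 0]]])
  qed
  have I_eq: "I \<omega> = integral {0..T} (\<lambda>s. v s * W s \<omega>)"
    if "W 0 \<omega> = 0" "continuous_on {0..T} (\<lambda>t. W t \<omega>)" for \<omega>
    unfolding I_def by (rule limI[OF R_lim[OF that]])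
  have R_I: "AE \<omega> in M. (\<lambda>n. R n \<omega>) \<longlonglongrightarrow> I \<omega>"
    using W_path
  proof eventually_elim
    case (elim \<omega>)
    then have "continuous_on {0..T} (\<lambda>t. W t \<omega>)" by (auto elim: continuous_on_subset)
    then show ?case using R_lim[of \<omega>] I_eq[of \<omega>] elim by simp
  qed
  define \<epsilon>1 where "\<epsilon>1 \<omega> = \<sigma> * W (T + \<delta>) \<omega>" for \<omega>
  define \<epsilon>2 where "\<epsilon>2 \<omega> = \<sigma> * (W (T + \<delta>) \<omega> / (1 + \<alpha>) - I \<omega> / q0)" for \<omega>
  have [measurable]: "\<epsilon>1 \<in> borel_measurable M" "\<epsilon>2 \<in> borel_measurable M"
    unfolding \<epsilon>1_def[abs_def] \<epsilon>2_def[abs_def] by measurable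
  have S_end: "S (T + \<delta>) \<omega> = S0 + \<sigma> * W (T + \<delta>) \<omega> - k * G q0"
    if "\<forall>t\<ge>0. S t \<omega> = S0 + \<sigma> * W t \<omega> - (LINT s:{0..t}|lebesgue. f \<bar>q0 - q s\<bar> * v s)" for \<omega>
    using that[rule_format, of "T + \<delta>"] impact_end \<open>T > 0\<close> \<open>\<delta> \<ge> 0\<close> by simp
  have eq1: "AE \<omega> in M. S (T + \<delta>) \<omega> - S0 = - k * sgn q0 * \<bar>q0\<bar> powr \<alpha> + \<epsilon>1 \<omega>"
    using S by eventually_elim (simp add: S_end \<epsilon>1_def G_def)
  have eq2: "AE \<omega> in M. (S (T + \<delta>) \<omega> + \<alpha> * S0) / (1 + \<alpha>) - (X T \<omega> - X0) / q0 = 1 / q0 * H + \<epsilon>2 \<omega>"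
    using S X W_path
  proof eventually_elim
    case (elim \<omega>)
    then have cont: "continuous_on {0..T} (\<lambda>t. W t \<omega>)" by (auto elim: continuous_on_subset)
    have "(\<lambda>s. W s \<omega> * v s) absolutely_integrable_on {0..T}"
      using cont by (intro absolutely_integrable_bounded_measurable_product_real v_int
        continuous_imp_measurable_on_sets_lebesgue compact_imp_bounded compact_continuous_image) auto
    then have vW: "(\<lambda>s. v s * W s \<omega>) absolutely_integrable_on {0..T}" by (simp add: mult.commute)
    have vW': "((\<lambda>s. v s * W s \<omega>) has_integral I \<omega>) {0..T}"
      using set_lebesgue_integral_eq_integral(1)[OF vW] I_eq[of \<omega>] elim cont by (simp add: has_integral_iff)
    \<comment> \<open>Inserting the price path splits the proceeds into initial price, noise and
      impact, each absolutely integrable on its own.\<close>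
    have "(LINT s:{0..T}|lebesgue. v s * S s \<omega>)
      = (LINT s:{0..T}|lebesgue. S0 * v s + \<sigma> * (v s * W s \<omega>) - k * G (u s) * v s)"
    proof (intro set_lebesgue_integral_cong allI impI)
      fix s assume s: "s \<in> {0..T}"
      then have S_s: "S s \<omega> = S0 + \<sigma> * W s \<omega> - k * G (u s)"
        using elim(1)[rule_format, of s] impact[OF s] by simp
      show "v s * S s \<omega> = S0 * v s + \<sigma> * (v s * W s \<omega>) - k * G (u s) * v s"
        unfolding S_s by (simp add: algebra_simps)
    qed simp
    also have "\<dots> = integral {0..T} (\<lambda>s. S0 * v s + \<sigma> * (v s * W s \<omega>) - k * G (u s) * v s)"
      by (intro set_lebesgue_integral_eq_integral(2) set_integral_diff(1) set_integral_add(1)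
          set_integrable_mult_right v_int vW Gv(2))
    also have "\<dots> = S0 * (u T - u 0) + \<sigma> * I \<omega> - (\<phi> (u T) - \<phi> (u 0))"
      using \<open>T > 0\<close> by (intro integral_unique has_integral_diff has_integral_add has_integral_mult_right v_ftc vW' Gv(1)) auto
    also have "\<dots> = S0 * q0 + \<sigma> * I \<omega> - k / (1 + \<alpha>) * (q0 * G q0)"
    proof -
      have "\<bar>q0\<bar> powr (1 + \<alpha>) = q0 * G q0"
        using \<open>q0 \<noteq> 0\<close> by (simp add: powr_add G_def sgn_if)
      then show ?thesis using \<open>0 < \<alpha>\<close> by (simp add: u0 \<phi>_def)
    qed
    finally have "X T \<omega> - X0 = S0 * q0 + \<sigma> * I \<omega> - k / (1 + \<alpha>) * (q0 * G q0) - H"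
      using elim(2) \<open>T > 0\<close> by (simp add: H_def)
    then have "(X T \<omega> - X0) / q0 = S0 + \<sigma> * (I \<omega> / q0) - k / (1 + \<alpha>) * G q0 - 1 / q0 * H"
      using \<open>q0 \<noteq> 0\<close> by (simp add: diff_divide_distrib add_divide_distrib)
    \<comment> \<open>The impact term here equals the one in the average proceeds above, so the
      difference retains only noise and the cost \<open>H\<close>.\<close>
    moreover have "(S (T + \<delta>) \<omega> + \<alpha> * S0) / (1 + \<alpha>) = S0 + \<sigma> * (W (T + \<delta>) \<omega> / (1 + \<alpha>)) - k / (1 + \<alpha>) * G q0"
    proof -
      have S_T': "S (T + \<delta>) \<omega> + \<alpha> * S0 = S0 * (1 + \<alpha>) + \<sigma> * W (T + \<delta>) \<omega> - k * G q0"
        unfolding S_end[OF elim(1)] by (simp add: algebra_simps)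
      have "1 + \<alpha> \<noteq> 0" using \<open>0 < \<alpha>\<close> by simp
      then show ?thesis unfolding S_T' diff_divide_distrib add_divide_distrib by simp
    qed
    ultimately show ?case by (simp add: \<epsilon>2_def right_diff_distrib)
  qed
  have p_cont: "continuous_on {0..T} p"
    unfolding p_def using \<open>q0 \<noteq> 0\<close> by (intro continuous_intros q_cont) auto
  then have p_int: "p absolutely_integrable_on {0..T}" "(\<lambda>t. (p t)\<^sup>2) absolutely_integrable_on {0..T}"
    by (auto intro!: absolutely_integrable_continuous_real continuous_intros)
  define P1 where "P1 = (LINT t:{0..T}|lebesgue. p t)"
  define P2 where "P2 = (LINT t:{0..T}|lebesgue. (p t)\<^sup>2)"
  have P: "(p has_integral P1) {0..T}" "((\<lambda>t. (p t)\<^sup>2) has_integral P2) {0..T}"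
    unfolding P1_def P2_def using p_int by (auto intro: has_integral_set_lebesgue)
  \<comment> \<open>A combination with coefficients \<open>a\<close>, \<open>b\<close> of the two
    errors has weight \<open>\<sigma> * (a - b * p t)\<close> on the time interval up to
    \<open>T\<close> and \<open>\<sigma> * (a + b / (1 + \<alpha>))\<close> after it. Expanding the
    squares gives the quadratic form of the covariance matrix.\<close>
  have var: "integral {0..T} (\<lambda>t. (\<sigma> * (a + b / (1 + \<alpha>)) - \<sigma> * b / q0 * q t)\<^sup>2) + (\<sigma> * (a + b / (1 + \<alpha>)))\<^sup>2 * \<delta>
    = a\<^sup>2 * (\<sigma>\<^sup>2 * (T + \<delta>)) + 2 * a * b * (\<sigma>\<^sup>2 * (\<delta> / (1 + \<alpha>) - P1)) + b\<^sup>2 * (\<sigma>\<^sup>2 * (\<delta> / (1 + \<alpha>)\<^sup>2 + P2))" for a b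
  proof -
    have int: "((\<lambda>t. \<sigma>\<^sup>2 * (a\<^sup>2 + (- 2 * a * b) * p t + b\<^sup>2 * (p t)\<^sup>2)) has_integral
        \<sigma>\<^sup>2 * (a\<^sup>2 * T + (- 2 * a * b) * P1 + b\<^sup>2 * P2)) {0..T}"
      using has_integral_const_real[of "a\<^sup>2" 0 T] \<open>T > 0\<close>
      by (intro has_integral_mult_right has_integral_add P) (simp add: mult.commute)
    have sq: "(\<sigma> * (a + b / (1 + \<alpha>)) - \<sigma> * b / q0 * q t)\<^sup>2 = \<sigma>\<^sup>2 * (a\<^sup>2 + (- 2 * a * b) * p t + b\<^sup>2 * (p t)\<^sup>2)" for t
    proof -
      have eq: "\<sigma> * (a + b / (1 + \<alpha>)) - \<sigma> * b / q0 * q t = \<sigma> * (a - b * p t)"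
        by (simp add: p_def algebra_simps)
      show ?thesis unfolding eq by (simp add: power2_eq_square algebra_simps)
    qed
    have "integral {0..T} (\<lambda>t. (\<sigma> * (a + b / (1 + \<alpha>)) - \<sigma> * b / q0 * q t)\<^sup>2)
      = \<sigma>\<^sup>2 * (a\<^sup>2 * T + (- 2 * a * b) * P1 + b\<^sup>2 * P2)"
      by (simp only: sq integral_unique[OF int])
    moreover have "(\<sigma> * (a + b / (1 + \<alpha>)))\<^sup>2 = \<sigma>\<^sup>2 * (a\<^sup>2 + 2 * a * b * (1 / (1 + \<alpha>)) + b\<^sup>2 * (1 / (1 + \<alpha>)\<^sup>2))"
      by (simp add: power_mult_distrib power2_sum power_divide)
    ultimately show ?thesis by (simp add: algebra_simps)
  qed
  have gauss: "gaussian_vector_with M (\<lambda>\<omega>. vector [\<epsilon>1 \<omega>, \<epsilon>2 \<omega>] :: real ^ 2) 0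
     (vector [vector [\<sigma>\<^sup>2 * (T + \<delta>), \<sigma>\<^sup>2 * (\<delta> / (1 + \<alpha>) - P1)],
              vector [\<sigma>\<^sup>2 * (\<delta> / (1 + \<alpha>) - P1), \<sigma>\<^sup>2 * (\<delta> / (1 + \<alpha>)\<^sup>2 + P2)]])"
  proof (rule gaussian_vector_with_if_char)
    fix a b x :: real
    \<comment> \<open>Positivity of the quadratic form is read off from \<open>var\<close>
      backwards: it is an integral of a square plus a square times \<delta>.\<close>
    have "continuous_on {0..T} (\<lambda>t. (\<sigma> * (a + b / (1 + \<alpha>)) - \<sigma> * b / q0 * q t)\<^sup>2)"
      by (intro continuous_intros q_cont)
    then have "integral {0..T} (\<lambda>t. (\<sigma> * (a + b / (1 + \<alpha>)) - \<sigma> * b / q0 * q t)\<^sup>2) \<ge> 0"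
      by (intro integral_nonneg integrable_continuous_real) auto
    then show "0 \<le> a\<^sup>2 * (\<sigma>\<^sup>2 * (T + \<delta>)) + 2 * a * b * (\<sigma>\<^sup>2 * (\<delta> / (1 + \<alpha>) - P1)) + b\<^sup>2 * (\<sigma>\<^sup>2 * (\<delta> / (1 + \<alpha>)\<^sup>2 + P2))"
      unfolding var[symmetric] using \<open>\<delta> \<ge> 0\<close> by simp
    have "(\<lambda>\<omega>. a * \<epsilon>1 \<omega> + b * \<epsilon>2 \<omega>) = (\<lambda>\<omega>. \<sigma> * (a + b / (1 + \<alpha>)) * W (T + \<delta>) \<omega> - \<sigma> * b / q0 * I \<omega>)"
      by (simp add: \<epsilon>1_def \<epsilon>2_def fun_eq_iff algebra_simps)
    then show "char (distr M borel (\<lambda>\<omega>. a * \<epsilon>1 \<omega> + b * \<epsilon>2 \<omega>)) x = complex_of_real (exp (- ((a\<^sup>2 * (\<sigma>\<^sup>2 * (T + \<delta>)) +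
        2 * a * b * (\<sigma>\<^sup>2 * (\<delta> / (1 + \<alpha>) - P1)) + b\<^sup>2 * (\<sigma>\<^sup>2 * (\<delta> / (1 + \<alpha>)\<^sup>2 + P2))) * x\<^sup>2) / 2))"
      using char_wiener_integral[OF \<open>T > 0\<close> \<open>\<delta> \<ge> 0\<close> q_cont _ R_I[unfolded R_def],
          of "\<sigma> * (a + b / (1 + \<alpha>))" "\<sigma> * b / q0" x]
      by (simp only: var) simp
  qed measurable
  have linear: "P1 = - (T * (1 / (1 + \<alpha>) - 1 / 2)) \<and> P2 = T / 3 * ((1 + \<alpha> ^ 3) / (1 + \<alpha>) ^ 3)"
    if lin: "\<forall>t\<in>{0..T}. q t = q0 * (1 - t / T)"
  proof -
    \<comment> \<open>For uniform liquidation \<open>p\<close> falls linearly from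
      \<open>c = \<alpha> / (1 + \<alpha>)\<close> to \<open>c - 1 = - 1 / (1 + \<alpha>)\<close>.
      The integral of its square is therefore a sum of two cubes, which accounts for
      \<open>1 + \<alpha> ^ 3\<close>.\<close>
    define c where "c = 1 - 1 / (1 + \<alpha>)"
    have p_eq: "p t = c - t / T" if "t \<in> {0..T}" for t
      using lin that \<open>q0 \<noteq> 0\<close> by (simp add: p_def c_def)
    have "((\<lambda>t. c - t / T) has_integral (c * T - T\<^sup>2 / (2 * T) - (c * 0 - 0\<^sup>2 / (2 * T)))) {0..T}"
      using \<open>T > 0\<close>
      by (intro fundamental_theorem_of_calculus)
        (auto intro!: derivative_eq_intros simp: has_real_derivative_iff_has_vector_derivative[symmetric] field_simps)
    then have "(p has_integral (c * T - T / 2)) {0..T}"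
      using \<open>T > 0\<close> by (subst has_integral_cong[OF p_eq]) (auto simp: power2_eq_square)
    then have P1_eq: "P1 = c * T - T / 2" using P(1) has_integral_unique by blast
    have sq: "((\<lambda>t. (c - t / T)\<^sup>2) has_integral (- T / 3 * (c - T / T) ^ 3 - (- T / 3 * (c - 0 / T) ^ 3))) {0..T}"
      using \<open>T > 0\<close>
      by (intro fundamental_theorem_of_calculus)
        (auto intro!: derivative_eq_intros simp: has_real_derivative_iff_has_vector_derivative[symmetric])
    have "((\<lambda>t. (p t)\<^sup>2) has_integral (T / 3 * (c ^ 3 + (1 - c) ^ 3))) {0..T}"
    proof (rule has_integral_eq_rhs[OF has_integral_eq[OF _ sq]])
      show "(c - t / T)\<^sup>2 = (p t)\<^sup>2" if "t \<in> {0..T}" for t by (simp add: p_eq[OF that])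
      show "T / 3 * (c ^ 3 + (1 - c) ^ 3) = - T / 3 * (c - T / T) ^ 3 - (- T / 3 * (c - 0 / T) ^ 3)"
        using \<open>T > 0\<close> by (simp add: power3_eq_cube algebra_simps)
    qed
    then have P2_eq: "P2 = T / 3 * (c ^ 3 + (1 - c) ^ 3)" using P(2) has_integral_unique by blast
    have cubes: "c ^ 3 + (1 - c) ^ 3 = (1 + \<alpha> ^ 3) / (1 + \<alpha>) ^ 3"
    proof -
      have "c = \<alpha> / (1 + \<alpha>)" "1 - c = 1 / (1 + \<alpha>)" using \<open>0 < \<alpha>\<close> by (auto simp: c_def field_simps)
      then show ?thesis by (simp only:) (simp add: power_divide add_divide_distrib)
    qed
    show ?thesis
    proof
      show "P1 = - (T * (1 / (1 + \<alpha>) - 1 / 2))" by (simp add: P1_eq c_def algebra_simps)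
      show "P2 = T / 3 * ((1 + \<alpha> ^ 3) / (1 + \<alpha>) ^ 3)" by (simp only: P2_eq cubes)
    qed
  qed
  have matrix: "r *\<^sub>R (vector [vector [a, b], vector [b, c]] :: real ^ 2 ^ 2)
      = vector [vector [r * a, r * b], vector [r * b, r * c]]" for r a b c :: real
    by (simp add: vec_eq_iff forall_2)
  show ?thesis
    unfolding matrix p_def[symmetric] P1_def[symmetric] P2_def[symmetric] H_def[symmetric]
  proof (intro exI conjI impI)
    show "AE \<omega> in M. S (T + \<delta>) \<omega> - S0 = - k * sgn q0 * \<bar>q0\<bar> powr \<alpha> + \<epsilon>1 \<omega>" by (rule eq1)
    show "AE \<omega> in M. (S (T + \<delta>) \<omega> + \<alpha> * S0) / (1 + \<alpha>) - (X T \<omega> - X0) / q0 = 1 / q0 * H + \<epsilon>2 \<omega>"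
      by (rule eq2)
    show "gaussian_vector_with M (\<lambda>\<omega>. vector [\<epsilon>1 \<omega>, \<epsilon>2 \<omega>] :: real ^ 2) 0
     (vector [vector [\<sigma>\<^sup>2 * (T + \<delta>), \<sigma>\<^sup>2 * (\<delta> / (1 + \<alpha>) - P1)],
              vector [\<sigma>\<^sup>2 * (\<delta> / (1 + \<alpha>) - P1), \<sigma>\<^sup>2 * (\<delta> / (1 + \<alpha>)\<^sup>2 + P2)]])"
      by (rule gauss)
    assume "\<forall>t\<in>{0..T}. q t = q0 * (1 - t / T)"
    then show "gaussian_vector_with M (\<lambda>\<omega>. vector [\<epsilon>1 \<omega>, \<epsilon>2 \<omega>] :: real ^ 2) 0
     (vector [vector [\<sigma>\<^sup>2 * (T + \<delta>), \<sigma>\<^sup>2 * (\<delta> / (1 + \<alpha>) + T * (1 / (1 + \<alpha>) - 1 / 2))],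
              vector [\<sigma>\<^sup>2 * (\<delta> / (1 + \<alpha>) + T * (1 / (1 + \<alpha>) - 1 / 2)),
                \<sigma>\<^sup>2 * (\<delta> / (1 + \<alpha>)\<^sup>2 + T / 3 * ((1 + \<alpha> ^ 3) / (1 + \<alpha>) ^ 3))]])"
      using gauss linear by (simp only: diff_minus_eq_add)
  qed
qed

end
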